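(* Let $\mathcal V$ be a (co)complete Heyting lattice, regarded as a thin cartesian monoidal category, and let $F\colon\mathcal C\to\mathcal D$ be a $\mathcal V$-functor. If $$\bigvee_{x_i\in F^*y_i}\mathcal C(x_1,x_2)\wedge\mathcal C(x_0,x_1)\;\cong\;\mathcal D(y_1,y_2)\wedge\mathcal D(y_0,y_1)$$ for all objects $y_0,y_1,y_2$ of $\mathcal D$, where the join runs over all triples $(x_0,x_1,x_2)$ of objects of $\mathcal C$ with $Fx_i=y_i$ for $i=0,1,2$, then $F$ is an effective descent $\mathcal V$-functor, i.e. an effective descent morphism in $\mathcal V\text{-}\mathsf{Cat}$.
   Context: A Heyting lattice is a thin category with finite meets (including a top element) that is cartesian closed, i.e. each $A\wedge-$ has a right adjoint; (co)complete means that all joins (equivalently, all meets) exist. $\mathcal V\text{-}\mathsf{Cat}$ is the category of $\mathcal V$-categories (enriched with tensor $\wedge$ and unit the top element) and $\mathcal V$-functors. Effective descent: let $\mathcal A$ be a category with pullbacks and $p\colon e\to b$ a morphism. Let $p^*\colon\mathcal A/b\to\mathcal A/e$ be the pullback functor, $p_!\dashv p^*$ its left adjoint, $T^p$ the induced monad, and $\mathcal K^p\colon\mathcal A/b\to T^p\text{-}\mathsf{Alg}$ the Eilenberg–Moore comparison functor. Then $p$ is an effective descent morphism if $\mathcal K^p$ is an equivalence.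
   Formalization: If the top of V is isomorphic to its empty join, F is also assumed surjective on objects; otherwise the claim fails there (empty category → 1). For all other V nothing is added. V-Cat consists of V-categories with objects in an arbitrary infinite set. *)

theory Defs
  imports "HOL-Library.FuncSet" "HOL-Library.Infinite_Typeclass"
begin

unbundle lattice_syntax

section \<open>Categories, functors, monads\<close>

record ('o, 'm) cat =
  Obj :: "'o set"
  Arr :: "'m set"
  Dom :: "'m \<Rightarrow> 'o"
  Cod :: "'m \<Rightarrow> 'o"
  Id :: "'o \<Rightarrow> 'm"
  Comp :: "'m \<Rightarrow> 'm \<Rightarrow> 'm" (infixl "\<cdot>\<index>" 70)

definition hom :: "('o, 'm) cat \<Rightarrow> 'o \<Rightarrow> 'o \<Rightarrow> 'm set" where
  "hom A x y = {f \<in> Arr A. Dom A f = x \<and> Cod A f = y}"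

locale category =
  fixes A :: "('o, 'm) cat" (structure)
  assumes dom_obj: "f \<in> Arr A \<Longrightarrow> Dom A f \<in> Obj A"
    and cod_obj: "f \<in> Arr A \<Longrightarrow> Cod A f \<in> Obj A"
    and id_hom: "x \<in> Obj A \<Longrightarrow> Id A x \<in> hom A x x"
    and comp_hom: "f \<in> hom A x y \<Longrightarrow> g \<in> hom A y z \<Longrightarrow> g \<cdot> f \<in> hom A x z"
    and id_comp: "f \<in> hom A x y \<Longrightarrow> Id A y \<cdot> f = f"
    and comp_id: "f \<in> hom A x y \<Longrightarrow> f \<cdot> Id A x = f"
    and comp_assoc:
      "f \<in> hom A w x \<Longrightarrow> g \<in> hom A x y \<Longrightarrow> h \<in> hom A y z \<Longrightarrow> (h \<cdot> g) \<cdot> f = h \<cdot> (g \<cdot> f)"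

definition is_iso :: "('o, 'm) cat \<Rightarrow> 'm \<Rightarrow> bool" where
  "is_iso A f \<longleftrightarrow> (\<exists>x y. f \<in> hom A x y \<and>
     (\<exists>g\<in>hom A y x. g \<cdot>\<^bsub>A\<^esub> f = Id A x \<and> f \<cdot>\<^bsub>A\<^esub> g = Id A y))"

record ('o1, 'm1, 'o2, 'm2) ftor =
  OMap :: "'o1 \<Rightarrow> 'o2"
  AMap :: "'m1 \<Rightarrow> 'm2"

locale is_functor = A: category A + B: category B
  for A :: "('o1, 'm1) cat" and B :: "('o2, 'm2) cat"
    and F :: "('o1, 'm1, 'o2, 'm2) ftor" +
  assumes map_obj: "x \<in> Obj A \<Longrightarrow> OMap F x \<in> Obj B"
    and map_hom: "f \<in> hom A x y \<Longrightarrow> AMap F f \<in> hom B (OMap F x) (OMap F y)"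
    and map_id: "x \<in> Obj A \<Longrightarrow> AMap F (Id A x) = Id B (OMap F x)"
    and map_comp: "f \<in> hom A x y \<Longrightarrow> g \<in> hom A y z \<Longrightarrow>
      AMap F (g \<cdot>\<^bsub>A\<^esub> f) = AMap F g \<cdot>\<^bsub>B\<^esub> AMap F f"

definition id_ftor :: "('o, 'm, 'o, 'm) ftor" where
  "id_ftor = \<lparr>OMap = (\<lambda>x. x), AMap = (\<lambda>f. f)\<rparr>"

definition comp_ftor ::
  "('o2, 'm2, 'o3, 'm3) ftor \<Rightarrow> ('o1, 'm1, 'o2, 'm2) ftor \<Rightarrow> ('o1, 'm1, 'o3, 'm3) ftor"
  (infixl "\<odot>" 70) where
  "G \<odot> F = \<lparr>OMap = (\<lambda>x. OMap G (OMap F x)), AMap = (\<lambda>f. AMap G (AMap F f))\<rparr>"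

locale nat_trans = F: is_functor A B F + G: is_functor A B G
  for A :: "('o1, 'm1) cat" and B :: "('o2, 'm2) cat" and F G
    and \<tau> :: "'o1 \<Rightarrow> 'm2" +
  assumes component: "x \<in> Obj A \<Longrightarrow> \<tau> x \<in> hom B (OMap F x) (OMap G x)"
    and naturality: "f \<in> hom A x y \<Longrightarrow> \<tau> y \<cdot>\<^bsub>B\<^esub> AMap F f = AMap G f \<cdot>\<^bsub>B\<^esub> \<tau> x"

locale nat_iso = nat_trans +
  assumes component_iso: "x \<in> Obj A \<Longrightarrow> is_iso B (\<tau> x)"

definition is_equivalence ::
  "('o1, 'm1) cat \<Rightarrow> ('o2, 'm2) cat \<Rightarrow> ('o1, 'm1, 'o2, 'm2) ftor \<Rightarrow> bool" where
  "is_equivalence A B F \<longleftrightarrow> is_functor A B F \<and>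
     (\<exists>G \<eta> \<epsilon>. is_functor B A G \<and>
        nat_iso A A id_ftor (G \<odot> F) \<eta> \<and> nat_iso B B (F \<odot> G) id_ftor \<epsilon>)"

locale adjunction =
  L: is_functor A B L + R: is_functor B A R +
  unit: nat_trans A A id_ftor "R \<odot> L" \<eta> +
  counit: nat_trans B B "L \<odot> R" id_ftor \<epsilon>
  for A :: "('o1, 'm1) cat" and B :: "('o2, 'm2) cat" and L R \<eta> \<epsilon> +
  assumes triangle_left: "x \<in> Obj A \<Longrightarrow>
      \<epsilon> (OMap L x) \<cdot>\<^bsub>B\<^esub> AMap L (\<eta> x) = Id B (OMap L x)"
    and triangle_right: "y \<in> Obj B \<Longrightarrow>
      AMap R (\<epsilon> y) \<cdot>\<^bsub>A\<^esub> \<eta> (OMap R y) = Id A (OMap R y)"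

record ('o, 'm) monad =
  Endo :: "('o, 'm, 'o, 'm) ftor"
  Unit :: "'o \<Rightarrow> 'm"
  Mult :: "'o \<Rightarrow> 'm"

definition induced_monad ::
  "('o1, 'm1, 'o2, 'm2) ftor \<Rightarrow> ('o2, 'm2, 'o1, 'm1) ftor \<Rightarrow> ('o1 \<Rightarrow> 'm1) \<Rightarrow> ('o2 \<Rightarrow> 'm2)
     \<Rightarrow> ('o1, 'm1) monad" where
  "induced_monad L R \<eta> \<epsilon> =
     \<lparr>Endo = R \<odot> L, Unit = \<eta>, Mult = (\<lambda>x. AMap R (\<epsilon> (OMap L x)))\<rparr>"

definition is_algebra :: "('o, 'm) cat \<Rightarrow> ('o, 'm) monad \<Rightarrow> 'o \<times> 'm \<Rightarrow> bool" where
  "is_algebra A T = (\<lambda>(x, a). x \<in> Obj A \<and> a \<in> hom A (OMap (Endo T) x) x \<and>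
     a \<cdot>\<^bsub>A\<^esub> Unit T x = Id A x \<and>
     a \<cdot>\<^bsub>A\<^esub> AMap (Endo T) a = a \<cdot>\<^bsub>A\<^esub> Mult T x)"

text \<open>The Eilenberg--Moore category. An arrow is stored together with its domain and
  codomain algebras, since these are not determined by the underlying arrow.\<close>

definition Alg ::
  "('o, 'm) cat \<Rightarrow> ('o, 'm) monad \<Rightarrow> ('o \<times> 'm, ('o \<times> 'm) \<times> 'm \<times> ('o \<times> 'm)) cat" where
  "Alg A T = \<lparr>
     Obj = {X. is_algebra A T X},
     Arr = {(X, h, Y). is_algebra A T X \<and> is_algebra A T Y \<and> h \<in> hom A (fst X) (fst Y) \<and>
              h \<cdot>\<^bsub>A\<^esub> snd X = snd Y \<cdot>\<^bsub>A\<^esub> AMap (Endo T) h},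
     Dom = (\<lambda>(X, h, Y). X),
     Cod = (\<lambda>(X, h, Y). Y),
     Id = (\<lambda>X. (X, Id A (fst X), X)),
     Comp = (\<lambda>(Y, k, Z) (X, h, Y'). (X, k \<cdot>\<^bsub>A\<^esub> h, Z))\<rparr>"

definition comparison ::
  "('o2, 'm2) cat \<Rightarrow> ('o2, 'm2, 'o1, 'm1) ftor \<Rightarrow> ('o2 \<Rightarrow> 'm2)
     \<Rightarrow> ('o2, 'm2, 'o1 \<times> 'm1, ('o1 \<times> 'm1) \<times> 'm1 \<times> ('o1 \<times> 'm1)) ftor" where
  "comparison B R \<epsilon> = (let K = (\<lambda>y. (OMap R y, AMap R (\<epsilon> y))) in
     \<lparr>OMap = K, AMap = (\<lambda>f. (K (Dom B f), AMap R f, K (Cod B f)))\<rparr>)"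


section \<open>Slices, pullbacks and effective descent\<close>

text \<open>An arrow of the slice over \<open>b\<close> from \<open>f\<close> to \<open>g\<close> is a triple \<open>(f, h, g)\<close> with
  \<open>g \<cdot> h = f\<close>.\<close>

definition slice :: "('o, 'm) cat \<Rightarrow> 'o \<Rightarrow> ('m, 'm \<times> 'm \<times> 'm) cat" where
  "slice A b = \<lparr>
     Obj = {f \<in> Arr A. Cod A f = b},
     Arr = {(f, h, g). f \<in> Arr A \<and> g \<in> Arr A \<and> Cod A f = b \<and> Cod A g = b \<and>
              h \<in> hom A (Dom A f) (Dom A g) \<and> g \<cdot>\<^bsub>A\<^esub> h = f},
     Dom = (\<lambda>(f, h, g). f),
     Cod = (\<lambda>(f, h, g). g),
     Id = (\<lambda>f. (f, Id A (Dom A f), f)),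
     Comp = (\<lambda>(g, k, l) (f, h, g'). (f, k \<cdot>\<^bsub>A\<^esub> h, l))\<rparr>"

definition is_pullback :: "('o, 'm) cat \<Rightarrow> 'm \<Rightarrow> 'm \<Rightarrow> 'm \<Rightarrow> 'm \<Rightarrow> bool" where
  "is_pullback A p f q r \<longleftrightarrow>
     q \<in> hom A (Dom A q) (Dom A p) \<and> r \<in> hom A (Dom A q) (Dom A f) \<and>
     p \<cdot>\<^bsub>A\<^esub> q = f \<cdot>\<^bsub>A\<^esub> r \<and>
     (\<forall>z. \<forall>s\<in>hom A z (Dom A p). \<forall>t\<in>hom A z (Dom A f). p \<cdot>\<^bsub>A\<^esub> s = f \<cdot>\<^bsub>A\<^esub> t \<longrightarrow>
        (\<exists>!h. h \<in> hom A z (Dom A q) \<and> q \<cdot>\<^bsub>A\<^esub> h = s \<and> r \<cdot>\<^bsub>A\<^esub> h = t))"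

locale category_with_pullbacks = category +
  assumes pullback_ex: "p \<in> Arr A \<Longrightarrow> f \<in> Arr A \<Longrightarrow> Cod A p = Cod A f \<Longrightarrow>
    \<exists>q r. is_pullback A p f q r"

text \<open>A chosen pullback \<open>pb1 A p f\<close>, \<open>pb2 A p f\<close> of \<open>f\<close> along \<open>p\<close>, where \<open>pb1 A p f\<close> has the
  same codomain as the domain of \<open>p\<close>.\<close>

definition pb :: "('o, 'm) cat \<Rightarrow> 'm \<Rightarrow> 'm \<Rightarrow> 'm \<times> 'm" where
  "pb A p f = (SOME (q, r). is_pullback A p f q r)"

abbreviation pb1 :: "('o, 'm) cat \<Rightarrow> 'm \<Rightarrow> 'm \<Rightarrow> 'm" where
  "pb1 A p f \<equiv> fst (pb A p f)"

abbreviation pb2 :: "('o, 'm) cat \<Rightarrow> 'm \<Rightarrow> 'm \<Rightarrow> 'm" where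
  "pb2 A p f \<equiv> snd (pb A p f)"

definition pb_induced :: "('o, 'm) cat \<Rightarrow> 'm \<Rightarrow> 'm \<Rightarrow> 'm \<Rightarrow> 'm \<Rightarrow> 'm" where
  "pb_induced A p f s t = (THE h. h \<in> hom A (Dom A s) (Dom A (pb1 A p f)) \<and>
     pb1 A p f \<cdot>\<^bsub>A\<^esub> h = s \<and> pb2 A p f \<cdot>\<^bsub>A\<^esub> h = t)"

definition pullback_ftor ::
  "('o, 'm) cat \<Rightarrow> 'm \<Rightarrow> ('m, 'm \<times> 'm \<times> 'm, 'm, 'm \<times> 'm \<times> 'm) ftor" where
  "pullback_ftor A p = \<lparr>
     OMap = pb1 A p,
     AMap = (\<lambda>(f, h, g).
       (pb1 A p f, pb_induced A p g (pb1 A p f) (h \<cdot>\<^bsub>A\<^esub> pb2 A p f), pb1 A p g))\<rparr>"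

definition postcomp_ftor ::
  "('o, 'm) cat \<Rightarrow> 'm \<Rightarrow> ('m, 'm \<times> 'm \<times> 'm, 'm, 'm \<times> 'm \<times> 'm) ftor" where
  "postcomp_ftor A p = \<lparr>
     OMap = (\<lambda>g. p \<cdot>\<^bsub>A\<^esub> g),
     AMap = (\<lambda>(f, h, g). (p \<cdot>\<^bsub>A\<^esub> f, h, p \<cdot>\<^bsub>A\<^esub> g))\<rparr>"

definition descent_unit :: "('o, 'm) cat \<Rightarrow> 'm \<Rightarrow> 'm \<Rightarrow> 'm \<times> 'm \<times> 'm" where
  "descent_unit A p g =
     (g, pb_induced A p (p \<cdot>\<^bsub>A\<^esub> g) g (Id A (Dom A g)), pb1 A p (p \<cdot>\<^bsub>A\<^esub> g))"

definition descent_counit :: "('o, 'm) cat \<Rightarrow> 'm \<Rightarrow> 'm \<Rightarrow> 'm \<times> 'm \<times> 'm" where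
  "descent_counit A p f = (p \<cdot>\<^bsub>A\<^esub> pb1 A p f, pb2 A p f, f)"

definition descent_monad :: "('o, 'm) cat \<Rightarrow> 'm \<Rightarrow> ('m, 'm \<times> 'm \<times> 'm) monad" where
  "descent_monad A p =
     induced_monad (postcomp_ftor A p) (pullback_ftor A p) (descent_unit A p) (descent_counit A p)"

text \<open>Meaningful for \<open>category_with_pullbacks A\<close>; any two choices of pullbacks give isomorphic
  functors \<open>pullback_ftor A p\<close>, so the notion does not depend on the choice.\<close>

definition effective_descent :: "('o, 'm) cat \<Rightarrow> 'm \<Rightarrow> bool" where
  "effective_descent A p \<longleftrightarrow> p \<in> Arr A \<and>
     is_equivalence (slice A (Cod A p)) (Alg (slice A (Dom A p)) (descent_monad A p))
       (comparison (slice A (Cod A p)) (pullback_ftor A p) (descent_counit A p))"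


text \<open>The data above do form the adjunction between composition with \<open>p\<close> and pullback along \<open>p\<close>.\<close>

lemma homI: "f \<in> Arr A \<Longrightarrow> Dom A f = x \<Longrightarrow> Cod A f = y \<Longrightarrow> f \<in> hom A x y"
  by (simp add: hom_def)

lemma homD: "f \<in> hom A x y \<Longrightarrow> f \<in> Arr A" "f \<in> hom A x y \<Longrightarrow> Dom A f = x" "f \<in> hom A x y \<Longrightarrow> Cod A f = y"
  by (auto simp: hom_def)

lemma slice_simps:
  "Obj (slice A b) = {f \<in> Arr A. Cod A f = b}"
  "Dom (slice A b) (f, h, g) = f" "Cod (slice A b) (f, h, g) = g"
  "Id (slice A b) f = (f, Id A (Dom A f), f)"
  "(g, k, l) \<cdot>\<^bsub>slice A b\<^esub> (f, h, g') = (f, k \<cdot>\<^bsub>A\<^esub> h, l)"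
  by (simp_all add: slice_def)

lemma hom_slice_iff:
  "u \<in> hom (slice A b) f g \<longleftrightarrow> (\<exists>h. u = (f, h, g) \<and> f \<in> Arr A \<and> g \<in> Arr A \<and>
     Cod A f = b \<and> Cod A g = b \<and> h \<in> hom A (Dom A f) (Dom A g) \<and> g \<cdot>\<^bsub>A\<^esub> h = f)"
  by (cases u) (auto simp: slice_def hom_def)

lemma comp_is_functor:
  assumes "is_functor A B F" "is_functor B C G"
  shows "is_functor A C (G \<odot> F)"
proof -
  interpret F: is_functor A B F by (rule assms)
  interpret G: is_functor B C G by (rule assms)
  show ?thesis
  proof
    fix f g x y z assume "f \<in> hom A x y" "g \<in> hom A y z"
    then show "AMap (G \<odot> F) (g \<cdot>\<^bsub>A\<^esub> f) = AMap (G \<odot> F) g \<cdot>\<^bsub>C\<^esub> AMap (G \<odot> F) f"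
      using F.map_comp G.map_comp[OF F.map_hom F.map_hom] by (simp add: comp_ftor_def)
  qed (simp_all add: comp_ftor_def F.map_obj G.map_obj F.map_hom G.map_hom F.map_id G.map_id)
qed

context category
begin

lemma comp_simps:
  assumes "f \<in> Arr A" "g \<in> Arr A" "Cod A f = Dom A g"
  shows "g \<cdot> f \<in> Arr A" "Dom A (g \<cdot> f) = Dom A f" "Cod A (g \<cdot> f) = Cod A g"
  using comp_hom[of f "Dom A f" "Dom A g" g "Cod A g"] assms by (auto simp: hom_def)

lemma assoc:
  assumes "f \<in> Arr A" "g \<in> Arr A" "h \<in> Arr A" "Cod A f = Dom A g" "Cod A g = Dom A h"
  shows "(h \<cdot> g) \<cdot> f = h \<cdot> (g \<cdot> f)"
  using comp_assoc[of f "Dom A f" "Dom A g" g "Dom A h" h "Cod A h"] assms by (auto simp: hom_def)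

lemma id_simps:
  assumes "x \<in> Obj A"
  shows "Id A x \<in> Arr A" "Dom A (Id A x) = x" "Cod A (Id A x) = x"
  using id_hom[OF assms] by (auto simp: hom_def)

lemma unit_simps:
  assumes "f \<in> Arr A"
  shows "Id A (Cod A f) \<cdot> f = f" "f \<cdot> Id A (Dom A f) = f"
  using assms id_comp[of f "Dom A f" "Cod A f"] comp_id[of f "Dom A f" "Cod A f"]
  by (auto simp: hom_def)

lemma category_slice: "category (slice A b)"
proof
  fix u assume "u \<in> Arr (slice A b)"
  then show "Dom (slice A b) u \<in> Obj (slice A b)" "Cod (slice A b) u \<in> Obj (slice A b)"
    by (auto simp: slice_def)
next
  fix f assume "f \<in> Obj (slice A b)"
  then show "Id (slice A b) f \<in> hom (slice A b) f f"
    by (simp add: hom_slice_iff slice_simps id_hom dom_obj unit_simps)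
next
  fix u v f g h assume "u \<in> hom (slice A b) f g" "v \<in> hom (slice A b) g h"
  then obtain k l where "u = (f, k, g)" "v = (g, l, h)" "f \<in> Arr A" "g \<in> Arr A" "h \<in> Arr A"
      "Cod A f = b" "Cod A g = b" "Cod A h = b" "g \<cdot> k = f" "h \<cdot> l = g"
      "k \<in> hom A (Dom A f) (Dom A g)" "l \<in> hom A (Dom A g) (Dom A h)"
    unfolding hom_slice_iff by blast
  then show "v \<cdot>\<^bsub>slice A b\<^esub> u \<in> hom (slice A b) f h"
    by (simp add: hom_slice_iff slice_simps comp_hom assoc[symmetric] homD)
next
  fix u f g assume "u \<in> hom (slice A b) f g"
  then obtain h where h: "u = (f, h, g)" "h \<in> hom A (Dom A f) (Dom A g)"
    by (auto simp: hom_slice_iff)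
  show "Id (slice A b) g \<cdot>\<^bsub>slice A b\<^esub> u = u"
    using h id_comp[of h] by (simp add: slice_simps)
  show "u \<cdot>\<^bsub>slice A b\<^esub> Id (slice A b) f = u"
    using h comp_id[of h] by (simp add: slice_simps)
next
  fix u v w f g h k
  assume "u \<in> hom (slice A b) f g" "v \<in> hom (slice A b) g h" "w \<in> hom (slice A b) h k"
  then obtain a b' c where "u = (f, a, g)" "v = (g, b', h)" "w = (h, c, k)"
      "a \<in> hom A (Dom A f) (Dom A g)" "b' \<in> hom A (Dom A g) (Dom A h)"
      "c \<in> hom A (Dom A h) (Dom A k)"
    unfolding hom_slice_iff by blast
  then show "w \<cdot>\<^bsub>slice A b\<^esub> v \<cdot>\<^bsub>slice A b\<^esub> u = w \<cdot>\<^bsub>slice A b\<^esub> (v \<cdot>\<^bsub>slice A b\<^esub> u)"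
    by (simp add: slice_simps comp_assoc)
qed

end

context category_with_pullbacks
begin

lemma pb_is_pullback:
  assumes "p \<in> Arr A" "f \<in> Arr A" "Cod A p = Cod A f"
  shows "is_pullback A p f (pb1 A p f) (pb2 A p f)"
proof -
  have "\<exists>z. case z of (q, r) \<Rightarrow> is_pullback A p f q r"
    using pullback_ex[OF assms] by auto
  then have "case pb A p f of (q, r) \<Rightarrow> is_pullback A p f q r"
    unfolding pb_def by (rule someI_ex)
  then show ?thesis by (simp add: case_prod_beta)
qed

lemma pb_simps:
  assumes "p \<in> Arr A" "f \<in> Arr A" "Cod A p = Cod A f"
  shows "pb1 A p f \<in> Arr A" "pb2 A p f \<in> Arr A"
    "Cod A (pb1 A p f) = Dom A p" "Cod A (pb2 A p f) = Dom A f"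
    "Dom A (pb2 A p f) = Dom A (pb1 A p f)"
    "p \<cdot> pb1 A p f = f \<cdot> pb2 A p f"
  using pb_is_pullback[OF assms] by (auto simp: is_pullback_def hom_def)

lemma pb_ex1:
  assumes "p \<in> Arr A" "f \<in> Arr A" "Cod A p = Cod A f"
    and "s \<in> Arr A" "t \<in> Arr A" "Dom A t = Dom A s" "Cod A s = Dom A p" "Cod A t = Dom A f"
    and "p \<cdot> s = f \<cdot> t"
  shows "\<exists>!h. h \<in> hom A (Dom A s) (Dom A (pb1 A p f)) \<and> pb1 A p f \<cdot> h = s \<and> pb2 A p f \<cdot> h = t"
proof -
  have "s \<in> hom A (Dom A s) (Dom A p)" "t \<in> hom A (Dom A s) (Dom A f)"
    using assms by (simp_all add: hom_def)
  then show ?thesis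
    using pb_is_pullback[OF assms(1-3)] assms(9) by (simp add: is_pullback_def)
qed

lemma pb_induced:
  assumes "p \<in> Arr A" "f \<in> Arr A" "Cod A p = Cod A f"
    and "s \<in> Arr A" "t \<in> Arr A" "Dom A t = Dom A s" "Cod A s = Dom A p" "Cod A t = Dom A f"
    and "p \<cdot> s = f \<cdot> t"
  shows "pb_induced A p f s t \<in> hom A (Dom A s) (Dom A (pb1 A p f))"
    "pb1 A p f \<cdot> pb_induced A p f s t = s" "pb2 A p f \<cdot> pb_induced A p f s t = t"
  using theI'[OF pb_ex1[OF assms]] unfolding pb_induced_def by blast+

lemma pb_unique:
  assumes "p \<in> Arr A" "f \<in> Arr A" "Cod A p = Cod A f"
    and "h \<in> hom A z (Dom A (pb1 A p f))" "k \<in> hom A z (Dom A (pb1 A p f))"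
    and "pb1 A p f \<cdot> h = pb1 A p f \<cdot> k" "pb2 A p f \<cdot> h = pb2 A p f \<cdot> k"
  shows "h = k"
proof -
  note [simp] = pb_simps[OF assms(1-3)]
  have h: "h \<in> Arr A" "Dom A h = z" "Cod A h = Dom A (pb1 A p f)"
    using assms by (auto simp: hom_def)
  have "p \<cdot> (pb1 A p f \<cdot> h) = f \<cdot> (pb2 A p f \<cdot> h)"
    using h assms(1-3) by (simp add: assoc[symmetric])
  then have "\<exists>!h'. h' \<in> hom A z (Dom A (pb1 A p f)) \<and>
      pb1 A p f \<cdot> h' = pb1 A p f \<cdot> h \<and> pb2 A p f \<cdot> h' = pb2 A p f \<cdot> h"
    using pb_ex1[OF assms(1-3), of "pb1 A p f \<cdot> h" "pb2 A p f \<cdot> h"] assms(1-3) h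
    by (simp add: comp_simps)
  then show ?thesis
    using assms(4-) by auto
qed

lemma pullback_map:
  assumes "p \<in> Arr A" "u \<in> hom (slice A (Cod A p)) f g"
  obtains h k where "u = (f, h, g)" "f \<in> Arr A" "g \<in> Arr A" "Cod A f = Cod A p" "Cod A g = Cod A p"
    "h \<in> hom A (Dom A f) (Dom A g)" "g \<cdot> h = f"
    "AMap (pullback_ftor A p) u = (pb1 A p f, k, pb1 A p g)"
    "k \<in> hom A (Dom A (pb1 A p f)) (Dom A (pb1 A p g))"
    "pb1 A p g \<cdot> k = pb1 A p f" "pb2 A p g \<cdot> k = h \<cdot> pb2 A p f"
proof -
  obtain h where u: "u = (f, h, g)" "f \<in> Arr A" "g \<in> Arr A" "Cod A f = Cod A p" "Cod A g = Cod A p"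
    "h \<in> hom A (Dom A f) (Dom A g)" "g \<cdot> h = f"
    using assms by (auto simp: hom_slice_iff)
  have h: "h \<in> Arr A" "Dom A h = Dom A f" "Cod A h = Dom A g"
    using u by (auto simp: hom_def)
  have eq: "p \<cdot> pb1 A p f = g \<cdot> (h \<cdot> pb2 A p f)"
    using u h assms(1) by (simp add: pb_simps assoc[symmetric])
  show thesis
    by (rule that[OF u])
      (use pb_induced[of p g "pb1 A p f" "h \<cdot> pb2 A p f"] assms(1) u h eq
        in \<open>simp_all add: pb_simps comp_simps pullback_ftor_def\<close>)
qed

lemma pullback_map':
  assumes "p \<in> Arr A" "(f, h, g) \<in> hom (slice A (Cod A p)) f g"
  shows "\<exists>k. AMap (pullback_ftor A p) (f, h, g) = (pb1 A p f, k, pb1 A p g) \<and>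
    k \<in> hom A (Dom A (pb1 A p f)) (Dom A (pb1 A p g)) \<and>
    pb1 A p g \<cdot> k = pb1 A p f \<and> pb2 A p g \<cdot> k = h \<cdot> pb2 A p f"
  by (rule pullback_map[OF assms]) simp

lemma pullback_functor:
  assumes p: "p \<in> Arr A"
  shows "is_functor (slice A (Cod A p)) (slice A (Dom A p)) (pullback_ftor A p)"
proof -
  interpret E: category "slice A (Dom A p)" by (rule category_slice)
  interpret B: category "slice A (Cod A p)" by (rule category_slice)
  have O [simp]: "OMap (pullback_ftor A p) f = pb1 A p f" for f by (simp add: pullback_ftor_def)
  show ?thesis
  proof
    fix f assume "f \<in> Obj (slice A (Cod A p))"
    then have f: "f \<in> Arr A" "Cod A f = Cod A p" by (auto simp: slice_simps)
    show "OMap (pullback_ftor A p) f \<in> Obj (slice A (Dom A p))"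
      using f p by (simp add: slice_simps pb_simps)
    have u: "(f, Id A (Dom A f), f) \<in> hom (slice A (Cod A p)) f f"
      using f by (simp add: hom_slice_iff id_hom dom_obj unit_simps)
    obtain k where k: "AMap (pullback_ftor A p) (f, Id A (Dom A f), f) = (pb1 A p f, k, pb1 A p f)"
      "k \<in> hom A (Dom A (pb1 A p f)) (Dom A (pb1 A p f))"
      "pb1 A p f \<cdot> k = pb1 A p f" "pb2 A p f \<cdot> k = Id A (Dom A f) \<cdot> pb2 A p f"
      using pullback_map'[OF p u] by blast
    note pbs = pb_simps[OF p f(1) f(2)[symmetric]]
    have 1: "Id A (Dom A f) \<cdot> pb2 A p f = pb2 A p f"
      using unit_simps(1)[OF pbs(2)] pbs(4) by simp
    have 2: "pb2 A p f \<cdot> Id A (Dom A (pb1 A p f)) = pb2 A p f"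
      using unit_simps(2)[OF pbs(2)] pbs(5) by simp
    have "k = Id A (Dom A (pb1 A p f))"
    proof (rule pb_unique[OF p f(1) f(2)[symmetric] k(2)])
      show "Id A (Dom A (pb1 A p f)) \<in> hom A (Dom A (pb1 A p f)) (Dom A (pb1 A p f))"
        using pbs(1) by (simp add: id_hom dom_obj)
      show "pb1 A p f \<cdot> k = pb1 A p f \<cdot> Id A (Dom A (pb1 A p f))"
        using k(3) unit_simps(2)[OF pbs(1)] by simp
      show "pb2 A p f \<cdot> k = pb2 A p f \<cdot> Id A (Dom A (pb1 A p f))"
        using k(4) 1 2 by simp
    qed
    then show "AMap (pullback_ftor A p) (Id (slice A (Cod A p)) f) =
        Id (slice A (Dom A p)) (OMap (pullback_ftor A p) f)"
      using k by (simp add: slice_simps)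
  next
    fix u f g assume "u \<in> hom (slice A (Cod A p)) f g"
    then show "AMap (pullback_ftor A p) u \<in>
        hom (slice A (Dom A p)) (OMap (pullback_ftor A p) f) (OMap (pullback_ftor A p) g)"
      by (rule pullback_map[OF p]) (use p in \<open>simp add: hom_slice_iff pb_simps\<close>)
  next
    fix u v f g h
    assume u: "u \<in> hom (slice A (Cod A p)) f g" and v: "v \<in> hom (slice A (Cod A p)) g h"
    obtain a k where 1: "u = (f, a, g)" "f \<in> Arr A" "g \<in> Arr A" "Cod A f = Cod A p" "Cod A g = Cod A p"
        "a \<in> hom A (Dom A f) (Dom A g)"
        "AMap (pullback_ftor A p) u = (pb1 A p f, k, pb1 A p g)"
        "k \<in> hom A (Dom A (pb1 A p f)) (Dom A (pb1 A p g))"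
        "pb1 A p g \<cdot> k = pb1 A p f" "pb2 A p g \<cdot> k = a \<cdot> pb2 A p f"
      by (rule pullback_map[OF p u])
    obtain b l where 2: "v = (g, b, h)" "h \<in> Arr A" "Cod A h = Cod A p"
        "b \<in> hom A (Dom A g) (Dom A h)"
        "AMap (pullback_ftor A p) v = (pb1 A p g, l, pb1 A p h)"
        "l \<in> hom A (Dom A (pb1 A p g)) (Dom A (pb1 A p h))"
        "pb1 A p h \<cdot> l = pb1 A p g" "pb2 A p h \<cdot> l = b \<cdot> pb2 A p g"
      by (rule pullback_map[OF p v])
    have vu: "v \<cdot>\<^bsub>slice A (Cod A p)\<^esub> u = (f, b \<cdot> a, h)"
      using 1 2 by (simp add: slice_simps)
    have "(f, b \<cdot> a, h) \<in> hom (slice A (Cod A p)) f h"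
      using B.comp_hom[OF u v] vu by simp
    then obtain m where 3: "AMap (pullback_ftor A p) (f, b \<cdot> a, h) = (pb1 A p f, m, pb1 A p h)"
        "m \<in> hom A (Dom A (pb1 A p f)) (Dom A (pb1 A p h))"
        "pb1 A p h \<cdot> m = pb1 A p f" "pb2 A p h \<cdot> m = (b \<cdot> a) \<cdot> pb2 A p f"
      using pullback_map'[OF p] by blast
    have "m = l \<cdot> k"
    proof (rule pb_unique[OF p 2(2) 2(3)[symmetric] 3(2)])
      show "l \<cdot> k \<in> hom A (Dom A (pb1 A p f)) (Dom A (pb1 A p h))"
        using 1(8) 2(6) by (rule comp_hom)
      note ss = p 1(2,3) 2(2) homD[OF 1(6)] homD[OF 1(8)] homD[OF 2(4)] homD[OF 2(6)]
        pb_simps(1-5)[OF p 1(2) 1(4)[symmetric]] pb_simps(1-5)[OF p 1(3) 1(5)[symmetric]]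
        pb_simps(1-5)[OF p 2(2) 2(3)[symmetric]]
      have "pb1 A p h \<cdot> (l \<cdot> k) = (pb1 A p h \<cdot> l) \<cdot> k"
        using ss by (simp add: assoc)
      then show "pb1 A p h \<cdot> m = pb1 A p h \<cdot> (l \<cdot> k)"
        using 1(9) 2(7) 3(3) by simp
      have "pb2 A p h \<cdot> (l \<cdot> k) = (pb2 A p h \<cdot> l) \<cdot> k"
        using ss by (simp add: assoc)
      also have "\<dots> = b \<cdot> (pb2 A p g \<cdot> k)"
        using ss 2(8) by (simp add: assoc)
      also have "\<dots> = (b \<cdot> a) \<cdot> pb2 A p f"
        using ss 1(10) by (simp add: assoc)
      finally show "pb2 A p h \<cdot> m = pb2 A p h \<cdot> (l \<cdot> k)"
        using 3(4) by simp
    qed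
    then show "AMap (pullback_ftor A p) (v \<cdot>\<^bsub>slice A (Cod A p)\<^esub> u) =
        AMap (pullback_ftor A p) v \<cdot>\<^bsub>slice A (Dom A p)\<^esub> AMap (pullback_ftor A p) u"
      using 1 2 3 vu by (simp add: slice_simps)
  qed
qed

lemma postcomp_functor:
  assumes p: "p \<in> Arr A"
  shows "is_functor (slice A (Dom A p)) (slice A (Cod A p)) (postcomp_ftor A p)"
proof -
  interpret E: category "slice A (Dom A p)" by (rule category_slice)
  interpret B: category "slice A (Cod A p)" by (rule category_slice)
  show ?thesis
  proof
    fix g assume "g \<in> Obj (slice A (Dom A p))"
    then have g: "g \<in> Arr A" "Cod A g = Dom A p" by (auto simp: slice_simps)
    then show "OMap (postcomp_ftor A p) g \<in> Obj (slice A (Cod A p))"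
      "AMap (postcomp_ftor A p) (Id (slice A (Dom A p)) g) =
        Id (slice A (Cod A p)) (OMap (postcomp_ftor A p) g)"
      using p by (simp_all add: slice_simps postcomp_ftor_def comp_simps)
  next
    fix u f g assume "u \<in> hom (slice A (Dom A p)) f g"
    then obtain h where h: "u = (f, h, g)" "f \<in> Arr A" "g \<in> Arr A" "Cod A f = Dom A p"
        "Cod A g = Dom A p" "h \<in> hom A (Dom A f) (Dom A g)" "g \<cdot> h = f"
      unfolding hom_slice_iff by blast
    have "(p \<cdot> g) \<cdot> h = p \<cdot> f"
      using h(2-5,7) homD[OF h(6)] p by (simp add: assoc)
    with h p show "AMap (postcomp_ftor A p) u \<in>
        hom (slice A (Cod A p)) (OMap (postcomp_ftor A p) f) (OMap (postcomp_ftor A p) g)"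
      by (simp add: hom_slice_iff postcomp_ftor_def comp_simps)
  next
    fix u v f g h
    assume "u \<in> hom (slice A (Dom A p)) f g" "v \<in> hom (slice A (Dom A p)) g h"
    then obtain a b where "u = (f, a, g)" "v = (g, b, h)"
      unfolding hom_slice_iff by blast
    then show "AMap (postcomp_ftor A p) (v \<cdot>\<^bsub>slice A (Dom A p)\<^esub> u) =
        AMap (postcomp_ftor A p) v \<cdot>\<^bsub>slice A (Cod A p)\<^esub> AMap (postcomp_ftor A p) u"
      by (simp add: slice_simps postcomp_ftor_def)
  qed
qed

lemma pullback_adjunction:
  assumes p: "p \<in> Arr A"
  shows "adjunction (slice A (Dom A p)) (slice A (Cod A p)) (postcomp_ftor A p) (pullback_ftor A p)
    (descent_unit A p) (descent_counit A p)"
proof -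
  let ?E = "slice A (Dom A p)" and ?B = "slice A (Cod A p)"
  let ?L = "postcomp_ftor A p" and ?R = "pullback_ftor A p"
  interpret L: is_functor ?E ?B ?L by (rule postcomp_functor[OF p])
  interpret R: is_functor ?B ?E ?R by (rule pullback_functor[OF p])
  have IE: "is_functor ?E ?E id_ftor" and IB: "is_functor ?B ?B id_ftor"
    by (unfold_locales; simp add: id_ftor_def)+
  have RL: "is_functor ?E ?E (?R \<odot> ?L)" and LR: "is_functor ?B ?B (?L \<odot> ?R)"
    by (blast intro: comp_is_functor L.is_functor_axioms R.is_functor_axioms)+
  have O [simp]: "OMap ?R f = pb1 A p f" "OMap ?L g = p \<cdot> g"
      "AMap ?L (g, h, g') = (p \<cdot> g, h, p \<cdot> g')" for f g h g'
    by (simp_all add: pullback_ftor_def postcomp_ftor_def)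
  have unit: "\<exists>h. descent_unit A p g = (g, h, pb1 A p (p \<cdot> g)) \<and>
      h \<in> hom A (Dom A g) (Dom A (pb1 A p (p \<cdot> g))) \<and> pb1 A p (p \<cdot> g) \<cdot> h = g \<and>
      pb2 A p (p \<cdot> g) \<cdot> h = Id A (Dom A g)" if g: "g \<in> Arr A" "Cod A g = Dom A p" for g
  proof -
    have eq: "(p \<cdot> g) \<cdot> Id A (Dom A g) = p \<cdot> g"
      using g p unit_simps(2)[of "p \<cdot> g"] by (simp add: comp_simps)
    show ?thesis
      using pb_induced[of p "p \<cdot> g" g "Id A (Dom A g)"] g p eq
      by (auto simp: descent_unit_def comp_simps id_simps dom_obj)
  qed
  have N1: "nat_trans ?E ?E id_ftor (?R \<odot> ?L) (descent_unit A p)"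
  proof (intro nat_trans.intro nat_trans_axioms.intro IE RL)
    fix g assume "g \<in> Obj ?E"
    then have g: "g \<in> Arr A" "Cod A g = Dom A p" by (auto simp: slice_simps)
    show "descent_unit A p g \<in> hom ?E (OMap id_ftor g) (OMap (?R \<odot> ?L) g)"
      using unit[OF g] g p by (auto simp: hom_slice_iff id_ftor_def comp_ftor_def pb_simps comp_simps)
  next
    fix u g g' assume u: "u \<in> hom ?E g g'"
    then obtain h where h: "u = (g, h, g')" "g \<in> Arr A" "g' \<in> Arr A" "Cod A g = Dom A p"
        "Cod A g' = Dom A p" "h \<in> hom A (Dom A g) (Dom A g')" "g' \<cdot> h = g"
      by (auto simp: hom_slice_iff)
    obtain a where a: "descent_unit A p g = (g, a, pb1 A p (p \<cdot> g))"
      "a \<in> hom A (Dom A g) (Dom A (pb1 A p (p \<cdot> g)))" "pb1 A p (p \<cdot> g) \<cdot> a = g"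
      "pb2 A p (p \<cdot> g) \<cdot> a = Id A (Dom A g)" using unit[OF h(2,4)] by blast
    obtain a' where a': "descent_unit A p g' = (g', a', pb1 A p (p \<cdot> g'))"
      "a' \<in> hom A (Dom A g') (Dom A (pb1 A p (p \<cdot> g')))" "pb1 A p (p \<cdot> g') \<cdot> a' = g'"
      "pb2 A p (p \<cdot> g') \<cdot> a' = Id A (Dom A g')" using unit[OF h(3,5)] by blast
    have pg: "p \<cdot> g \<in> Arr A" "p \<cdot> g' \<in> Arr A" "Cod A (p \<cdot> g) = Cod A p" "Cod A (p \<cdot> g') = Cod A p"
      "Dom A (p \<cdot> g) = Dom A g" "Dom A (p \<cdot> g') = Dom A g'"
      using h p by (simp_all add: comp_simps)
    have "(p \<cdot> g, h, p \<cdot> g') \<in> hom ?B (p \<cdot> g) (p \<cdot> g')" using L.map_hom[OF u] h(1) by simp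
    then obtain k where k: "AMap ?R (p \<cdot> g, h, p \<cdot> g') = (pb1 A p (p \<cdot> g), k, pb1 A p (p \<cdot> g'))"
        "k \<in> hom A (Dom A (pb1 A p (p \<cdot> g))) (Dom A (pb1 A p (p \<cdot> g')))"
        "pb1 A p (p \<cdot> g') \<cdot> k = pb1 A p (p \<cdot> g)" "pb2 A p (p \<cdot> g') \<cdot> k = h \<cdot> pb2 A p (p \<cdot> g)"
      using pullback_map'[OF p] by blast
    have "a' \<cdot> h = k \<cdot> a"
    proof (rule pb_unique[OF p pg(2) pg(4)[symmetric]])
      show "a' \<cdot> h \<in> hom A (Dom A g) (Dom A (pb1 A p (p \<cdot> g')))"
        using h(6) a'(2) by (rule comp_hom)
      show "k \<cdot> a \<in> hom A (Dom A g) (Dom A (pb1 A p (p \<cdot> g')))"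
        using a(2) k(2) by (rule comp_hom)
      note ss = homD[OF h(6)] homD[OF a(2)] homD[OF a'(2)] homD[OF k(2)] pb_simps[OF p pg(1)] pb_simps[OF p pg(2)] pg
      have "pb1 A p (p \<cdot> g') \<cdot> (a' \<cdot> h) = g" "pb1 A p (p \<cdot> g') \<cdot> (k \<cdot> a) = g"
        using ss by (simp_all add: assoc[symmetric] a a' k h)
      then show "pb1 A p (p \<cdot> g') \<cdot> (a' \<cdot> h) = pb1 A p (p \<cdot> g') \<cdot> (k \<cdot> a)" by simp
      have "pb2 A p (p \<cdot> g') \<cdot> (a' \<cdot> h) = Id A (Dom A g') \<cdot> h"
        using ss by (simp add: assoc[symmetric] a')
      also have "\<dots> = h \<cdot> Id A (Dom A g)"
        using h id_comp[OF h(6)] comp_id[OF h(6)] by simp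
      also have "\<dots> = (h \<cdot> pb2 A p (p \<cdot> g)) \<cdot> a"
        using ss by (simp add: assoc a)
      also have "\<dots> = pb2 A p (p \<cdot> g') \<cdot> (k \<cdot> a)"
        using ss by (simp add: assoc[symmetric] k(4)[symmetric])
      finally show "pb2 A p (p \<cdot> g') \<cdot> (a' \<cdot> h) = pb2 A p (p \<cdot> g') \<cdot> (k \<cdot> a)" .
    qed
    then show "descent_unit A p g' \<cdot>\<^bsub>?E\<^esub> AMap id_ftor u = AMap (?R \<odot> ?L) u \<cdot>\<^bsub>?E\<^esub> descent_unit A p g"
      using a a' k h by (simp add: id_ftor_def comp_ftor_def slice_simps)
  qed
  have N2: "nat_trans ?B ?B (?L \<odot> ?R) id_ftor (descent_counit A p)"
  proof (intro nat_trans.intro nat_trans_axioms.intro IB LR)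
    fix f assume "f \<in> Obj ?B"
    then have f: "f \<in> Arr A" "Cod A f = Cod A p" by (auto simp: slice_simps)
    show "descent_counit A p f \<in> hom ?B (OMap (?L \<odot> ?R) f) (OMap id_ftor f)"
      using f p pb_simps[OF p f(1)]
      by (simp add: hom_slice_iff id_ftor_def comp_ftor_def descent_counit_def comp_simps homI)
  next
    fix u f g assume "u \<in> hom ?B f g"
    then obtain h k where "u = (f, h, g)" "AMap ?R u = (pb1 A p f, k, pb1 A p g)"
      "pb2 A p g \<cdot> k = h \<cdot> pb2 A p f"
      by (rule pullback_map[OF p])
    then show "descent_counit A p g \<cdot>\<^bsub>?B\<^esub> AMap (?L \<odot> ?R) u = AMap id_ftor u \<cdot>\<^bsub>?B\<^esub> descent_counit A p f"
      by (simp add: id_ftor_def comp_ftor_def slice_simps descent_counit_def)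
  qed
  have T1: "descent_counit A p (OMap ?L g) \<cdot>\<^bsub>?B\<^esub> AMap ?L (descent_unit A p g) = Id ?B (OMap ?L g)"
    if "g \<in> Obj ?E" for g
  proof -
    have g: "g \<in> Arr A" "Cod A g = Dom A p" using that by (auto simp: slice_simps)
    show ?thesis
      using unit[OF g] g p by (auto simp: descent_counit_def slice_simps comp_simps)
  qed
  have T2: "AMap ?R (descent_counit A p f) \<cdot>\<^bsub>?E\<^esub> descent_unit A p (OMap ?R f) = Id ?E (OMap ?R f)"
    if f': "f \<in> Obj ?B" for f
  proof -
    have f: "f \<in> Arr A" "Cod A f = Cod A p" using f' by (auto simp: slice_simps)
    let ?q = "pb1 A p f" and ?r = "pb2 A p f"
    note qr = pb_simps[OF p f(1) f(2)[symmetric]]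
    have pq: "p \<cdot> ?q \<in> Arr A" "Cod A (p \<cdot> ?q) = Cod A p" "Dom A (p \<cdot> ?q) = Dom A ?q"
      using p qr(1-5) by (simp_all add: comp_simps)
    obtain a where a: "descent_unit A p ?q = (?q, a, pb1 A p (p \<cdot> ?q))"
      "a \<in> hom A (Dom A ?q) (Dom A (pb1 A p (p \<cdot> ?q)))" "pb1 A p (p \<cdot> ?q) \<cdot> a = ?q"
      "pb2 A p (p \<cdot> ?q) \<cdot> a = Id A (Dom A ?q)" using unit[OF qr(1,3)] by blast
    have "(p \<cdot> ?q, ?r, f) \<in> hom ?B (p \<cdot> ?q) f"
      using pq qr(1-5) qr(6)[symmetric] f by (simp add: hom_slice_iff homI)
    then obtain k where k: "AMap ?R (p \<cdot> ?q, ?r, f) = (pb1 A p (p \<cdot> ?q), k, ?q)"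
        "k \<in> hom A (Dom A (pb1 A p (p \<cdot> ?q))) (Dom A ?q)"
        "?q \<cdot> k = pb1 A p (p \<cdot> ?q)" "?r \<cdot> k = ?r \<cdot> pb2 A p (p \<cdot> ?q)"
      using pullback_map'[OF p] by blast
    note pq' = pb_simps[OF p pq(1) pq(2)[symmetric]]
    have "k \<cdot> a = Id A (Dom A ?q)"
    proof (rule pb_unique[OF p f(1) f(2)[symmetric]])
      show "k \<cdot> a \<in> hom A (Dom A ?q) (Dom A ?q)" using a(2) k(2) by (rule comp_hom)
      show "Id A (Dom A ?q) \<in> hom A (Dom A ?q) (Dom A ?q)" using qr by (simp add: id_hom dom_obj)
      note ss = homD[OF a(2)] homD[OF k(2)] qr(1-5) pq pq'(1-5)
      have "?q \<cdot> (k \<cdot> a) = ?q"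
        using ss by (simp add: assoc[symmetric] a k)
      then show "?q \<cdot> (k \<cdot> a) = ?q \<cdot> Id A (Dom A ?q)" using qr by (simp add: unit_simps)
      have "?r \<cdot> (k \<cdot> a) = (?r \<cdot> pb2 A p (p \<cdot> ?q)) \<cdot> a"
        using ss by (simp add: assoc[symmetric] k(4)[symmetric])
      also have "\<dots> = ?r \<cdot> Id A (Dom A ?q)"
        using ss by (simp add: assoc a)
      finally show "?r \<cdot> (k \<cdot> a) = ?r \<cdot> Id A (Dom A ?q)" .
    qed
    then show ?thesis
      using a k by (simp add: descent_counit_def slice_simps)
  qed
  show ?thesis
    by (intro adjunction.intro adjunction_axioms.intro L.is_functor_axioms R.is_functor_axioms N1 N2 T1 T2)
qed

end


section \<open>Complete Heyting lattices\<close>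

text \<open>A thin category is a preorder, so meets and joins are only determined up to isomorphism
  and antisymmetry is not assumed; \<^const>\<open>inf\<close>, \<^const>\<open>top\<close> and \<^const>\<open>Sup\<close> are chosen ones.\<close>

class complete_heyting = preorder + inf + top + Sup +
  assumes meet_le1: "a \<sqinter> b \<le> a"
    and meet_le2: "a \<sqinter> b \<le> b"
    and meet_greatest: "c \<le> a \<Longrightarrow> c \<le> b \<Longrightarrow> c \<le> a \<sqinter> b"
    and le_one: "a \<le> \<top>"
    and join_upper: "a \<in> S \<Longrightarrow> a \<le> \<Squnion>S"
    and join_least: "(\<And>a. a \<in> S \<Longrightarrow> a \<le> c) \<Longrightarrow> \<Squnion>S \<le> c"
    and meet_right_adjoint: "\<exists>r. \<forall>b c. a \<sqinter> b \<le> c \<longleftrightarrow> b \<le> r c"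

subclass (in complete_distrib_lattice) complete_heyting
proof
  fix a :: 'a
  have "a \<sqinter> b \<le> c \<longleftrightarrow> b \<le> \<Squnion>{x. a \<sqinter> x \<le> c}" for b c
  proof
    assume "b \<le> \<Squnion>{x. a \<sqinter> x \<le> c}"
    then have "a \<sqinter> b \<le> a \<sqinter> \<Squnion>{x. a \<sqinter> x \<le> c}"
      by (rule inf_mono[OF order_refl])
    also have "\<dots> \<le> c"
      by (auto simp: inf_Sup intro: SUP_least)
    finally show "a \<sqinter> b \<le> c" .
  qed (auto intro: Sup_upper)
  then show "\<exists>r. \<forall>b c. a \<sqinter> b \<le> c \<longleftrightarrow> b \<le> r c"
    by (intro exI[where x = "\<lambda>c. \<Squnion>{x. a \<sqinter> x \<le> c}"]) blast
qed (auto intro: Sup_upper Sup_least)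

definition thin_iso :: "'v::preorder \<Rightarrow> 'v \<Rightarrow> bool" (infix "\<cong>" 50) where
  "a \<cong> b \<longleftrightarrow> a \<le> b \<and> b \<le> a"


section \<open>The category of small enriched categories\<close>

text \<open>Objects of the enriched categories are taken from an infinite type \<open>'u\<close>, which plays
  the role of the universe bounding their size. Values of \<open>VHom\<close> off the carrier \<open>VOb\<close> are
  irrelevant: changing them gives an isomorphic object of \<open>VCat\<close>. Since the enriching
  category is thin, the associativity and unit axioms hold automatically.\<close>

record ('u, 'v) vcat =
  VOb :: "'u set"
  VHom :: "'u \<Rightarrow> 'u \<Rightarrow> 'v"

locale vcategory =
  fixes C :: "('u, 'v::complete_heyting) vcat"
  assumes vid: "x \<in> VOb C \<Longrightarrow> \<top> \<le> VHom C x x"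
    and vcomp: "x \<in> VOb C \<Longrightarrow> y \<in> VOb C \<Longrightarrow> z \<in> VOb C \<Longrightarrow>
      VHom C y z \<sqinter> VHom C x y \<le> VHom C x z"

record ('u, 'v) vfun =
  Src :: "('u, 'v) vcat"
  Tgt :: "('u, 'v) vcat"
  VMap :: "'u \<Rightarrow> 'u"

text \<open>The object map is extensional, so that equal \<open>\<V>\<close>-functors are equal as records.\<close>

locale vfunctor = Src: vcategory "Src F" + Tgt: vcategory "Tgt F"
  for F :: "('u, 'v::complete_heyting) vfun" +
  assumes vmap: "VMap F \<in> VOb (Src F) \<rightarrow>\<^sub>E VOb (Tgt F)"
    and vmap_hom: "x \<in> VOb (Src F) \<Longrightarrow> y \<in> VOb (Src F) \<Longrightarrow>
      VHom (Src F) x y \<le> VHom (Tgt F) (VMap F x) (VMap F y)"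

definition VCat :: "(('u, 'v::complete_heyting) vcat, ('u, 'v) vfun) cat" where
  "VCat = \<lparr>
     Obj = {C. vcategory C},
     Arr = {F. vfunctor F},
     Dom = Src,
     Cod = Tgt,
     Id = (\<lambda>C. \<lparr>Src = C, Tgt = C, VMap = restrict (\<lambda>x. x) (VOb C)\<rparr>),
     Comp = (\<lambda>G F. \<lparr>Src = Src F, Tgt = Tgt G, VMap = compose (VOb (Src F)) (VMap G) (VMap F)\<rparr>)\<rparr>"

lemma VCat_simps:
  "Obj VCat = {C. vcategory C}" "Arr VCat = {F. vfunctor F}" "Dom VCat = Src" "Cod VCat = Tgt"
  "Id VCat C = \<lparr>Src = C, Tgt = C, VMap = restrict (\<lambda>x. x) (VOb C)\<rparr>"
  "Comp VCat G F = \<lparr>Src = Src F, Tgt = Tgt G, VMap = compose (VOb (Src F)) (VMap G) (VMap F)\<rparr>"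
  by (simp_all add: VCat_def)

lemma meet_mono:
  fixes a b c d :: "'v::complete_heyting"
  assumes "a \<le> c" "b \<le> d"
  shows "a \<sqinter> b \<le> c \<sqinter> d"
  using assms by (meson meet_greatest meet_le1 meet_le2 order_trans)

lemma vfun_eqI:
  "Src F = Src G \<Longrightarrow> Tgt F = Tgt G \<Longrightarrow> VMap F = VMap G \<Longrightarrow> F = (G :: ('u, 'v) vfun)"
  by simp

lemma vfunctor_iff:
  "vfunctor F \<longleftrightarrow> vcategory (Src F) \<and> vcategory (Tgt F) \<and>
     VMap F \<in> VOb (Src F) \<rightarrow>\<^sub>E VOb (Tgt F) \<and>
     (\<forall>x\<in>VOb (Src F). \<forall>y\<in>VOb (Src F). VHom (Src F) x y \<le> VHom (Tgt F) (VMap F x) (VMap F y))"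
  by (auto simp: vfunctor_def vfunctor_axioms_def)

lemma category_VCat: "category (VCat :: (('u, 'v::complete_heyting) vcat, ('u, 'v) vfun) cat)"
proof
  fix F :: "('u, 'v) vfun"
  assume "F \<in> Arr VCat"
  then show "Dom VCat F \<in> Obj VCat" "Cod VCat F \<in> Obj VCat"
    by (simp_all add: VCat_simps vfunctor_iff)
next
  fix C :: "('u, 'v) vcat"
  assume "C \<in> Obj VCat"
  then show "Id VCat C \<in> hom VCat C C"
    by (simp add: hom_def VCat_simps vfunctor_iff)
next
  fix F :: "('u, 'v) vfun" and C D
  assume "F \<in> hom VCat C D"
  then have *: "VMap F \<in> VOb C \<rightarrow>\<^sub>E VOb D" "Src F = C" "Tgt F = D"
    by (auto simp: hom_def VCat_simps vfunctor_iff)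
  have "compose (VOb C) (\<lambda>x\<in>VOb D. x) (VMap F) = VMap F"
    "compose (VOb C) (VMap F) (\<lambda>x\<in>VOb C. x) = VMap F"
    using * by (auto simp: compose_def fun_eq_iff PiE_iff extensional_def)
  with * show "Id VCat D \<cdot>\<^bsub>VCat\<^esub> F = F" "F \<cdot>\<^bsub>VCat\<^esub> Id VCat C = F"
    by (simp_all add: VCat_simps)
next
  fix F G :: "('u, 'v) vfun" and B C D
  assume "F \<in> hom VCat B C" "G \<in> hom VCat C D"
  then have F: "vfunctor F" "Src F = B" "Tgt F = C" and G: "vfunctor G" "Src G = C" "Tgt G = D"
    by (simp_all add: hom_def VCat_simps)
  have mem: "VMap F x \<in> VOb C" if "x \<in> VOb B" for x
    using F that by (auto simp: vfunctor_iff)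
  have "VHom B x y \<le> VHom D (VMap G (VMap F x)) (VMap G (VMap F y))"
    if "x \<in> VOb B" "y \<in> VOb B" for x y
  proof -
    have "VHom B x y \<le> VHom C (VMap F x) (VMap F y)"
      using F that by (simp add: vfunctor_iff)
    also have "\<dots> \<le> VHom D (VMap G (VMap F x)) (VMap G (VMap F y))"
      using G mem that by (simp add: vfunctor_iff)
    finally show ?thesis .
  qed
  moreover have "compose (VOb B) (VMap G) (VMap F) \<in> VOb B \<rightarrow>\<^sub>E VOb D"
    using G mem by (auto simp: compose_def vfunctor_iff)
  ultimately show "G \<cdot>\<^bsub>VCat\<^esub> F \<in> hom VCat B D"
    using F G by (simp add: hom_def VCat_simps vfunctor_iff compose_eq)
next
  fix F G H :: "('u, 'v) vfun" and A B C D
  assume "F \<in> hom VCat A B" "G \<in> hom VCat B C" "H \<in> hom VCat C D"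
  then have "Src F = A" "Src G = B" "VMap F \<in> VOb A \<rightarrow>\<^sub>E VOb B"
    by (auto simp: hom_def VCat_simps vfunctor_iff)
  then show "H \<cdot>\<^bsub>VCat\<^esub> G \<cdot>\<^bsub>VCat\<^esub> F = H \<cdot>\<^bsub>VCat\<^esub> (G \<cdot>\<^bsub>VCat\<^esub> F)"
    by (auto simp: VCat_simps compose_def fun_eq_iff PiE_iff)
qed

lemma ex_inj_prod: "\<exists>i :: 'u::infinite \<times> 'u \<Rightarrow> 'u. inj i"
proof -
  have "ordIso2 (card_of (UNIV :: ('u \<times> 'u) set)) (card_of (UNIV :: 'u set))"
    using card_of_Times_same_infinite[OF infinite_UNIV[where 'a = 'u]] by simp
  then show ?thesis
    by (meson bij_betw_def card_of_ordIso)
qed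

lemma pullbacks_VCat:
  "category_with_pullbacks (VCat :: (('u::infinite, 'v::complete_heyting) vcat, ('u, 'v) vfun) cat)"
proof -
  interpret category "VCat :: (('u::infinite, 'v::complete_heyting) vcat, ('u, 'v) vfun) cat"
    by (rule category_VCat)
  obtain i :: "'u \<times> 'u \<Rightarrow> 'u" where i: "inj i"
    using ex_inj_prod by blast
  define j where "j = inv i"
  have ji [simp]: "j (i z) = z" for z
    using i by (simp add: j_def)
  show ?thesis
  proof
    fix p f :: "('u, 'v) vfun"
    assume "p \<in> Arr VCat" "f \<in> Arr VCat" "Cod VCat p = Cod VCat f"
    then have p: "vfunctor p" and f: "vfunctor f" and eq: "Tgt p = Tgt f"
      by (auto simp: VCat_simps)
    define U where "U = i ` {(x, y). x \<in> VOb (Src p) \<and> y \<in> VOb (Src f) \<and> VMap p x = VMap f y}"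
    define P where "P = \<lparr>VOb = U,
      VHom = (\<lambda>u v. VHom (Src p) (fst (j u)) (fst (j v)) \<sqinter> VHom (Src f) (snd (j u)) (snd (j v)))\<rparr>"
    have P [simp]: "VOb P = U" "VHom P u v =
        VHom (Src p) (fst (j u)) (fst (j v)) \<sqinter> VHom (Src f) (snd (j u)) (snd (j v))" for u v
      by (auto simp: P_def)
    define q where "q = \<lparr>Src = P, Tgt = Src p, VMap = restrict (\<lambda>u. fst (j u)) U\<rparr>"
    define r where "r = \<lparr>Src = P, Tgt = Src f, VMap = restrict (\<lambda>u. snd (j u)) U\<rparr>"
    have U: "fst (j u) \<in> VOb (Src p)" "snd (j u) \<in> VOb (Src f)"
        "VMap p (fst (j u)) = VMap f (snd (j u))" "i (j u) = u" if "u \<in> U" for u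
      using that by (auto simp: U_def)
    have Sp: "vcategory (Src p)" and Sf: "vcategory (Src f)"
      using p f by (auto simp: vfunctor_iff)
    have vP: "vcategory P"
    proof
      fix u assume "u \<in> VOb P"
      then show "\<top> \<le> VHom P u u"
        using U[of u] by (auto intro!: meet_greatest vcategory.vid Sp Sf)
    next
      fix u v w assume "u \<in> VOb P" "v \<in> VOb P" "w \<in> VOb P"
      then have *: "u \<in> U" "v \<in> U" "w \<in> U" by auto
      have "VHom P v w \<sqinter> VHom P u v \<le> VHom (Src p) (fst (j v)) (fst (j w)) \<sqinter> VHom (Src p) (fst (j u)) (fst (j v))"
        by (auto intro: meet_mono meet_le1)
      also have "\<dots> \<le> VHom (Src p) (fst (j u)) (fst (j w))"
        using * U by (intro vcategory.vcomp[OF Sp]) auto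
      finally have 1: "VHom P v w \<sqinter> VHom P u v \<le> VHom (Src p) (fst (j u)) (fst (j w))" .
      have "VHom P v w \<sqinter> VHom P u v \<le> VHom (Src f) (snd (j v)) (snd (j w)) \<sqinter> VHom (Src f) (snd (j u)) (snd (j v))"
        by (auto intro: meet_mono meet_le2)
      also have "\<dots> \<le> VHom (Src f) (snd (j u)) (snd (j w))"
        using * U by (intro vcategory.vcomp[OF Sf]) auto
      finally show "VHom P v w \<sqinter> VHom P u v \<le> VHom P u w"
        using 1 by (auto intro: meet_greatest)
    qed
    have q: "q \<in> hom VCat P (Src p)" and r: "r \<in> hom VCat P (Src f)"
      using vP Sp Sf U
      by (auto simp: hom_def VCat_simps vfunctor_iff q_def r_def intro: meet_le1 meet_le2)
    have "is_pullback VCat p f q r"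
      unfolding is_pullback_def
    proof (intro conjI allI ballI impI)
      show "q \<in> hom VCat (Dom VCat q) (Dom VCat p)" "r \<in> hom VCat (Dom VCat q) (Dom VCat f)"
        using q r by (auto simp: VCat_simps hom_def)
      show "p \<cdot>\<^bsub>VCat\<^esub> q = f \<cdot>\<^bsub>VCat\<^esub> r"
        using eq U by (auto simp: VCat_simps q_def r_def compose_def intro!: ext)
      fix Z s t
      assume s': "s \<in> hom VCat Z (Dom VCat p)" and t': "t \<in> hom VCat Z (Dom VCat f)"
        and st: "p \<cdot>\<^bsub>VCat\<^esub> s = f \<cdot>\<^bsub>VCat\<^esub> t"
      from s' t' have s: "vfunctor s" "Src s = Z" "Tgt s = Src p"
        and t: "vfunctor t" "Src t = Z" "Tgt t = Src f"
        by (auto simp: hom_def VCat_simps)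
      have Z: "vcategory Z" using s by (auto simp: vfunctor_iff)
      have st_eq: "VMap p (VMap s z) = VMap f (VMap t z)" if "z \<in> VOb Z" for z
      proof -
        have "VMap (p \<cdot>\<^bsub>VCat\<^esub> s) z = VMap (f \<cdot>\<^bsub>VCat\<^esub> t) z" by (simp only: st)
        then show ?thesis using that s t by (simp add: VCat_simps compose_def)
      qed
      have mem: "VMap s z \<in> VOb (Src p)" "VMap t z \<in> VOb (Src f)" if "z \<in> VOb Z" for z
        using s t that by (auto simp: vfunctor_iff)
      define h where "h = \<lparr>Src = Z, Tgt = P, VMap = (\<lambda>z\<in>VOb Z. i (VMap s z, VMap t z))\<rparr>"
      have h: "h \<in> hom VCat Z (Dom VCat q)"
        using Z vP s t mem st_eq
        by (auto simp: hom_def VCat_simps vfunctor_iff h_def q_def U_def intro!: meet_greatest)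
      have ext_s: "VMap s z = undefined" "VMap t z = undefined" if "z \<notin> VOb Z" for z
        using that s t by (auto simp: vfunctor_iff)
      have hU: "i (VMap s z, VMap t z) \<in> U" if "z \<in> VOb Z" for z
        using that mem st_eq by (auto simp: U_def)
      have "q \<cdot>\<^bsub>VCat\<^esub> h = s" "r \<cdot>\<^bsub>VCat\<^esub> h = t"
        using s t ext_s hU by (auto intro!: vfun_eqI ext simp: VCat_simps h_def q_def r_def compose_def)
      moreover have "k = h" if k: "k \<in> hom VCat Z (Dom VCat q)"
        and qk: "q \<cdot>\<^bsub>VCat\<^esub> k = s" and rk: "r \<cdot>\<^bsub>VCat\<^esub> k = t" for k
      proof (rule vfun_eqI)
        have k': "vfunctor k" "Src k = Z" "Tgt k = P"
          using k by (auto simp: hom_def VCat_simps q_def)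
        then show "Src k = Src h" "Tgt k = Tgt h" by (auto simp: h_def)
        have kU: "VMap k z \<in> U" if "z \<in> VOb Z" for z
          using k' that by (auto simp: vfunctor_iff)
        show "VMap k = VMap h"
        proof
          fix z
          show "VMap k z = VMap h z"
          proof (cases "z \<in> VOb Z")
            case True
            have "VMap s z = fst (j (VMap k z))" "VMap t z = snd (j (VMap k z))"
              unfolding qk[symmetric] rk[symmetric]
              using True kU k' by (auto simp: VCat_simps q_def r_def compose_def)
            then show ?thesis
              using True U(4)[OF kU] by (simp add: h_def)
          next
            case False
            then show ?thesis using k' by (auto simp: h_def vfunctor_iff)
          qed
        qed
      qed
      ultimately show "\<exists>!h. h \<in> hom VCat Z (Dom VCat q) \<and> q \<cdot>\<^bsub>VCat\<^esub> h = s \<and> r \<cdot>\<^bsub>VCat\<^esub> h = t"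
        using h by blast
    qed
    then show "\<exists>q r. is_pullback VCat p f q r" by blast
  qed
qed

end

theory Submission
  imports Defs
begin

text \<open>
  Writing \<open>\<pi>1\<close>, \<open>\<pi>2\<close> for the projections of the pullback \<open>P f\<close> of \<open>f\<close> along \<open>p\<close>, an algebra for
  the descent monad is a \<open>\<V>\<close>-functor \<open>g : Z \<rightarrow> C\<close> with a partial action \<open>act x z\<close>, defined when
  \<open>p x = p (g z)\<close>, that moves \<open>z\<close> to the fibre of \<open>g\<close> over \<open>x\<close>. The comparison functor is fully
  faithful because every \<open>\<pi>2\<close> is a quotient map: it is surjective on objects, and the homs of its
  codomain are joins of homs between lifts. For essential surjectivity, \<open>Z\<close> is the pullback of
  its quotient \<open>Q\<close> by the action, where \<open>Q v v'\<close> is the join of the homs between the orbits of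
  \<open>v\<close> and \<open>v'\<close>. In the composition law of \<open>Q\<close> two homs \<open>w0 \<rightarrow> w1\<close>, \<open>w1' \<rightarrow> w2\<close> of \<open>Z\<close> meet only in
  the orbit of the middle object; the hypothesis on composable pairs replaces their image in \<open>D\<close>
  by a pair \<open>x0 \<rightarrow> x1 \<rightarrow> x2\<close> in \<open>C\<close>, and acting with it moves both \<open>w1\<close> and \<open>w1'\<close> to the same object
  over \<open>x1\<close>.
\<close>

section \<open>Equivalences and Eilenberg--Moore categories\<close>

lemma is_isoI:
  assumes "f \<in> hom A x y" "g \<in> hom A y x" "g \<cdot>\<^bsub>A\<^esub> f = Id A x" "f \<cdot>\<^bsub>A\<^esub> g = Id A y"
  shows "is_iso A f"
  using assms by (auto simp: is_iso_def)

lemma is_isoE: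
  assumes "is_iso A f" "f \<in> hom A x y"
  obtains g where "g \<in> hom A y x" "g \<cdot>\<^bsub>A\<^esub> f = Id A x" "f \<cdot>\<^bsub>A\<^esub> g = Id A y"
  using assms by (auto simp: is_iso_def hom_def)

lemma id_is_functor: "category A \<Longrightarrow> is_functor A A id_ftor"
  unfolding is_functor_def is_functor_axioms_def id_ftor_def by simp

text \<open>The quasi-inverse is built by choice: an object \<open>y\<close> goes to some
  \<open>S y\<close> whose image is isomorphic to \<open>y\<close> via \<open>E y\<close>, and an
  arrow goes to the lift, unique by faithfulness, of its conjugate by these isomorphisms.\<close>

lemma (in is_functor) is_equivalenceI:
  assumes faithful: "\<And>x y f f'. f \<in> hom A x y \<Longrightarrow> f' \<in> hom A x y \<Longrightarrow> AMap F f = AMap F f' \<Longrightarrow> f = f'"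
    and full: "\<And>x y g. x \<in> Obj A \<Longrightarrow> y \<in> Obj A \<Longrightarrow> g \<in> hom B (OMap F x) (OMap F y) \<Longrightarrow>
      \<exists>f\<in>hom A x y. AMap F f = g"
    and ess_surj: "\<And>y. y \<in> Obj B \<Longrightarrow> \<exists>x\<in>Obj A. \<exists>e\<in>hom B (OMap F x) y. is_iso B e"
  shows "is_equivalence A B F"
proof -
  have "\<forall>y\<in>Obj B. \<exists>x e e'. x \<in> Obj A \<and> e \<in> hom B (OMap F x) y \<and> e' \<in> hom B y (OMap F x) \<and>
      e' \<cdot>\<^bsub>B\<^esub> e = Id B (OMap F x) \<and> e \<cdot>\<^bsub>B\<^esub> e' = Id B y"
    by (meson ess_surj is_isoE)
  then obtain S where S: "\<forall>y\<in>Obj B. \<exists>e e'. S y \<in> Obj A \<and> e \<in> hom B (OMap F (S y)) y \<and>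
      e' \<in> hom B y (OMap F (S y)) \<and> e' \<cdot>\<^bsub>B\<^esub> e = Id B (OMap F (S y)) \<and> e \<cdot>\<^bsub>B\<^esub> e' = Id B y"
    by metis
  then obtain E where E: "\<forall>y\<in>Obj B. \<exists>e'. S y \<in> Obj A \<and> E y \<in> hom B (OMap F (S y)) y \<and>
      e' \<in> hom B y (OMap F (S y)) \<and> e' \<cdot>\<^bsub>B\<^esub> E y = Id B (OMap F (S y)) \<and> E y \<cdot>\<^bsub>B\<^esub> e' = Id B y"
    by metis
  then obtain E' where E': "\<forall>y\<in>Obj B. S y \<in> Obj A \<and> E y \<in> hom B (OMap F (S y)) y \<and>
      E' y \<in> hom B y (OMap F (S y)) \<and> E' y \<cdot>\<^bsub>B\<^esub> E y = Id B (OMap F (S y)) \<and> E y \<cdot>\<^bsub>B\<^esub> E' y = Id B y"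
    by metis
  then have S: "\<And>y. y \<in> Obj B \<Longrightarrow> S y \<in> Obj A"
    and E: "\<And>y. y \<in> Obj B \<Longrightarrow> E y \<in> hom B (OMap F (S y)) y"
    and E': "\<And>y. y \<in> Obj B \<Longrightarrow> E' y \<in> hom B y (OMap F (S y))"
    and E'E: "\<And>y. y \<in> Obj B \<Longrightarrow> E' y \<cdot>\<^bsub>B\<^esub> E y = Id B (OMap F (S y))"
    and EE': "\<And>y. y \<in> Obj B \<Longrightarrow> E y \<cdot>\<^bsub>B\<^esub> E' y = Id B y"
    by blast+
  define lift where "lift x y g = (SOME f. f \<in> hom A x y \<and> AMap F f = g)" for x y g
  have lift: "lift x y g \<in> hom A x y" "AMap F (lift x y g) = g"
    if "x \<in> Obj A" "y \<in> Obj A" "g \<in> hom B (OMap F x) (OMap F y)" for x y g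
    using someI_ex[of "\<lambda>f. f \<in> hom A x y \<and> AMap F f = g"] full[OF that] unfolding lift_def by auto
  define conj where "conj g = E' (Cod B g) \<cdot>\<^bsub>B\<^esub> (g \<cdot>\<^bsub>B\<^esub> E (Dom B g))" for g
  define G where "G = \<lparr>OMap = S, AMap = (\<lambda>g. lift (S (Dom B g)) (S (Cod B g)) (conj g))\<rparr>"
  have objs: "x \<in> Obj B" "y \<in> Obj B" if "g \<in> hom B x y" for g x y
    using that B.dom_obj B.cod_obj by (auto simp: hom_def)
  have conj: "conj g \<in> hom B (OMap F (S x)) (OMap F (S y))" "E y \<cdot>\<^bsub>B\<^esub> conj g = g \<cdot>\<^bsub>B\<^esub> E x"
    if g: "g \<in> hom B x y" for g x y
  proof -
    note xy = objs[OF g]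
    have c: "conj g = E' y \<cdot>\<^bsub>B\<^esub> (g \<cdot>\<^bsub>B\<^esub> E x)" using g by (simp add: conj_def hom_def)
    have gE: "g \<cdot>\<^bsub>B\<^esub> E x \<in> hom B (OMap F (S x)) y" using B.comp_hom[OF E g] xy by simp
    show "conj g \<in> hom B (OMap F (S x)) (OMap F (S y))"
      unfolding c using B.comp_hom[OF gE E'] xy by simp
    have "E y \<cdot>\<^bsub>B\<^esub> conj g = (E y \<cdot>\<^bsub>B\<^esub> E' y) \<cdot>\<^bsub>B\<^esub> (g \<cdot>\<^bsub>B\<^esub> E x)"
      unfolding c using B.comp_assoc[OF gE E' E] xy by simp
    also have "\<dots> = g \<cdot>\<^bsub>B\<^esub> E x" using EE' xy B.id_comp[OF gE] by simp
    finally show "E y \<cdot>\<^bsub>B\<^esub> conj g = g \<cdot>\<^bsub>B\<^esub> E x" .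
  qed
  \<comment> \<open>Each \<open>E y\<close> is monic. The functor laws of \<open>G\<close> and the
    naturality of \<open>\<eta>\<close> are all proved in the same way: apply \<open>F\<close>,
    cancel \<open>E y\<close>, and conclude by faithfulness.\<close>
  have E_cancel: "g = g'" if "g \<in> hom B x (OMap F (S y))" "g' \<in> hom B x (OMap F (S y))" "y \<in> Obj B"
      "E y \<cdot>\<^bsub>B\<^esub> g = E y \<cdot>\<^bsub>B\<^esub> g'" for g g' x y
  proof -
    have "g = (E' y \<cdot>\<^bsub>B\<^esub> E y) \<cdot>\<^bsub>B\<^esub> g" using that B.id_comp by (simp add: E'E)
    also have "\<dots> = (E' y \<cdot>\<^bsub>B\<^esub> E y) \<cdot>\<^bsub>B\<^esub> g'"
      using that B.comp_assoc[OF that(1) E E'] B.comp_assoc[OF that(2) E E'] by simp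
    also have "\<dots> = g'" using that B.id_comp by (simp add: E'E)
    finally show ?thesis .
  qed
  have G_hom: "AMap G g \<in> hom A (S x) (S y)" and FG: "AMap F (AMap G g) = conj g"
    if g: "g \<in> hom B x y" for g x y
    using lift[OF S S conj(1)[OF g]] objs[OF g] g by (auto simp: G_def hom_def)
  have OG: "OMap G = S" by (simp add: G_def)
  have G: "is_functor B A G"
  proof
    fix x assume x: "x \<in> Obj B"
    then show "OMap G x \<in> Obj A" by (simp add: OG S)
    have "AMap F (AMap G (Id B x)) = AMap F (Id A (S x))"
      unfolding FG[OF B.id_hom[OF x]] map_id[OF S[OF x]]
    proof (rule E_cancel[OF conj(1)[OF B.id_hom[OF x]] B.id_hom x])
      show "OMap F (S x) \<in> Obj B" using x by (simp add: S map_obj)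
      show "E x \<cdot>\<^bsub>B\<^esub> conj (Id B x) = E x \<cdot>\<^bsub>B\<^esub> Id B (OMap F (S x))"
        using conj(2)[OF B.id_hom[OF x]] B.id_comp[OF E[OF x]] B.comp_id[OF E[OF x]] by simp
    qed
    then show "AMap G (Id B x) = Id A (OMap G x)"
      unfolding OG using faithful[OF G_hom[OF B.id_hom[OF x]] A.id_hom[OF S[OF x]]] by simp
  next
    fix g x y assume "g \<in> hom B x y"
    then show "AMap G g \<in> hom A (OMap G x) (OMap G y)" by (simp add: G_hom OG)
  next
    fix g h x y z assume g: "g \<in> hom B x y" and h: "h \<in> hom B y z"
    note hg = B.comp_hom[OF g h]
    have "AMap F (AMap G (h \<cdot>\<^bsub>B\<^esub> g)) = AMap F (AMap G h \<cdot>\<^bsub>A\<^esub> AMap G g)"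
      unfolding FG[OF hg] map_comp[OF G_hom[OF g] G_hom[OF h]] FG[OF g] FG[OF h]
    proof (rule E_cancel[OF conj(1)[OF hg] B.comp_hom[OF conj(1)[OF g] conj(1)[OF h]] objs(2)[OF h]])
      have "E z \<cdot>\<^bsub>B\<^esub> conj (h \<cdot>\<^bsub>B\<^esub> g) = h \<cdot>\<^bsub>B\<^esub> (g \<cdot>\<^bsub>B\<^esub> E x)"
        using conj(2)[OF hg] B.comp_assoc[OF E g h] objs[OF g] by simp
      also have "\<dots> = (h \<cdot>\<^bsub>B\<^esub> E y) \<cdot>\<^bsub>B\<^esub> conj g"
        using conj(2)[OF g] B.comp_assoc[OF conj(1)[OF g] E h] objs[OF g] by simp
      also have "\<dots> = E z \<cdot>\<^bsub>B\<^esub> (conj h \<cdot>\<^bsub>B\<^esub> conj g)"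
        using conj(2)[OF h] B.comp_assoc[OF conj(1)[OF g] conj(1)[OF h] E] objs[OF h] by simp
      finally show "E z \<cdot>\<^bsub>B\<^esub> conj (h \<cdot>\<^bsub>B\<^esub> g) = E z \<cdot>\<^bsub>B\<^esub> (conj h \<cdot>\<^bsub>B\<^esub> conj g)" .
    qed
    then show "AMap G (h \<cdot>\<^bsub>B\<^esub> g) = AMap G h \<cdot>\<^bsub>A\<^esub> AMap G g"
      by (rule faithful[OF G_hom[OF hg] A.comp_hom[OF G_hom[OF g] G_hom[OF h]]])
  qed
  note GF = comp_is_functor[OF is_functor_axioms G] and FG_ftor = comp_is_functor[OF G is_functor_axioms]
  have eps: "nat_iso B B (F \<odot> G) id_ftor E"
  proof (intro nat_iso.intro nat_trans.intro nat_trans_axioms.intro nat_iso_axioms.intro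
      FG_ftor id_is_functor B.category_axioms)
    fix y assume y: "y \<in> Obj B"
    show "E y \<in> hom B (OMap (F \<odot> G) y) (OMap id_ftor y)"
      using E[OF y] by (simp add: OG comp_ftor_def id_ftor_def)
    show "is_iso B (E y)"
      by (rule is_isoI[OF E[OF y] E'[OF y] E'E[OF y] EE'[OF y]])
  next
    fix g x y assume g: "g \<in> hom B x y"
    show "E y \<cdot>\<^bsub>B\<^esub> AMap (F \<odot> G) g = AMap id_ftor g \<cdot>\<^bsub>B\<^esub> E x"
      using conj(2)[OF g] by (simp add: FG[OF g] comp_ftor_def id_ftor_def)
  qed
  \<comment> \<open>The inverse of \<open>E (OMap F x)\<close> goes from \<open>F x\<close> to
    \<open>F (S (F x))\<close>; fullness turns it into an arrow out of \<open>x\<close>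
    itself.\<close>
  define \<eta> where "\<eta> x = lift x (S (OMap F x)) (E' (OMap F x))" for x
  have eta: "\<eta> x \<in> hom A x (S (OMap F x))" "AMap F (\<eta> x) = E' (OMap F x)" if "x \<in> Obj A" for x
    using that lift[OF _ S E'] unfolding \<eta>_def by (simp_all add: map_obj)
  have "nat_iso A A id_ftor (G \<odot> F) \<eta>"
  proof (intro nat_iso.intro nat_trans.intro nat_trans_axioms.intro nat_iso_axioms.intro
      GF id_is_functor A.category_axioms)
    fix x assume x: "x \<in> Obj A"
    show "\<eta> x \<in> hom A (OMap id_ftor x) (OMap (G \<odot> F) x)"
      using eta[OF x] by (simp add: OG comp_ftor_def id_ftor_def)
    note Fx = map_obj[OF x]
    obtain f where f: "f \<in> hom A (S (OMap F x)) x" "AMap F f = E (OMap F x)"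
      using full[OF S[OF Fx] x E[OF Fx]] by blast
    have "f \<cdot>\<^bsub>A\<^esub> \<eta> x = Id A x"
      by (rule faithful[OF A.comp_hom[OF eta(1)[OF x] f(1)] A.id_hom[OF x]])
        (simp add: map_comp[OF eta(1)[OF x] f(1)] f eta x EE' Fx map_id)
    moreover have "\<eta> x \<cdot>\<^bsub>A\<^esub> f = Id A (S (OMap F x))"
      by (rule faithful[OF A.comp_hom[OF f(1) eta(1)[OF x]] A.id_hom[OF S[OF Fx]]])
        (simp add: map_comp[OF f(1) eta(1)[OF x]] f eta x E'E Fx map_id S)
    ultimately show "is_iso A (\<eta> x)"
      by (rule is_isoI[OF eta(1)[OF x] f(1)])
  next
    fix f x y assume f: "f \<in> hom A x y"
    then have xy: "x \<in> Obj A" "y \<in> Obj A" using A.dom_obj A.cod_obj by (auto simp: hom_def)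
    note Ff = map_hom[OF f] and Fy = map_obj[OF xy(2)] and Fx = map_obj[OF xy(1)]
    have l: "AMap F (\<eta> y \<cdot>\<^bsub>A\<^esub> f) = E' (OMap F y) \<cdot>\<^bsub>B\<^esub> AMap F f"
      using map_comp[OF f eta(1)[OF xy(2)]] eta xy by simp
    have r: "AMap F (AMap G (AMap F f) \<cdot>\<^bsub>A\<^esub> \<eta> x) = conj (AMap F f) \<cdot>\<^bsub>B\<^esub> E' (OMap F x)"
      using map_comp[OF eta(1)[OF xy(1)] G_hom[OF Ff]] eta xy FG[OF Ff] by simp
    have "E' (OMap F y) \<cdot>\<^bsub>B\<^esub> AMap F f = conj (AMap F f) \<cdot>\<^bsub>B\<^esub> E' (OMap F x)"
    proof (rule E_cancel[OF B.comp_hom[OF Ff E'[OF Fy]] B.comp_hom[OF E'[OF Fx] conj(1)[OF Ff]] Fy])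
      have "E (OMap F y) \<cdot>\<^bsub>B\<^esub> (E' (OMap F y) \<cdot>\<^bsub>B\<^esub> AMap F f) = AMap F f"
        using B.comp_assoc[OF Ff E'[OF Fy] E[OF Fy]] EE'[OF Fy] B.id_comp[OF Ff] by simp
      moreover have "E (OMap F y) \<cdot>\<^bsub>B\<^esub> (conj (AMap F f) \<cdot>\<^bsub>B\<^esub> E' (OMap F x)) = AMap F f"
        using B.comp_assoc[OF E'[OF Fx] conj(1)[OF Ff] E[OF Fy]] conj(2)[OF Ff]
          B.comp_assoc[OF E'[OF Fx] E[OF Fx] Ff] EE'[OF Fx] B.comp_id[OF Ff] by simp
      ultimately show "E (OMap F y) \<cdot>\<^bsub>B\<^esub> (E' (OMap F y) \<cdot>\<^bsub>B\<^esub> AMap F f) =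
          E (OMap F y) \<cdot>\<^bsub>B\<^esub> (conj (AMap F f) \<cdot>\<^bsub>B\<^esub> E' (OMap F x))" by simp
    qed
    then have "\<eta> y \<cdot>\<^bsub>A\<^esub> f = AMap G (AMap F f) \<cdot>\<^bsub>A\<^esub> \<eta> x"
      by (intro faithful[OF A.comp_hom[OF f eta(1)[OF xy(2)]] A.comp_hom[OF eta(1)[OF xy(1)] G_hom[OF Ff]]])
        (simp add: l r)
    then show "\<eta> y \<cdot>\<^bsub>A\<^esub> AMap id_ftor f = AMap (G \<odot> F) f \<cdot>\<^bsub>A\<^esub> \<eta> x"
      by (simp add: comp_ftor_def id_ftor_def)
  qed
  with G eps show ?thesis
    unfolding is_equivalence_def using is_functor_axioms by blast
qed

section \<open>The Eilenberg--Moore category and the comparison functor\<close>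

lemma Alg_simps:
  "Obj (Alg A T) = {X. is_algebra A T X}"
  "Dom (Alg A T) (X, h, Y) = X" "Cod (Alg A T) (X, h, Y) = Y"
  "Id (Alg A T) X = (X, Id A (fst X), X)"
  "(Y, k, Z) \<cdot>\<^bsub>Alg A T\<^esub> (X, h, Y') = (X, k \<cdot>\<^bsub>A\<^esub> h, Z)"
  by (simp_all add: Alg_def)

lemma hom_Alg_iff:
  "u \<in> hom (Alg A T) X Y \<longleftrightarrow> (\<exists>h. u = (X, h, Y) \<and> is_algebra A T X \<and> is_algebra A T Y \<and>
     h \<in> hom A (fst X) (fst Y) \<and> h \<cdot>\<^bsub>A\<^esub> snd X = snd Y \<cdot>\<^bsub>A\<^esub> AMap (Endo T) h)"
  by (cases u) (auto simp: Alg_def hom_def)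

lemma is_algebra_iff:
  "is_algebra A T X \<longleftrightarrow> fst X \<in> Obj A \<and> snd X \<in> hom A (OMap (Endo T) (fst X)) (fst X) \<and>
     snd X \<cdot>\<^bsub>A\<^esub> Unit T (fst X) = Id A (fst X) \<and>
     snd X \<cdot>\<^bsub>A\<^esub> AMap (Endo T) (snd X) = snd X \<cdot>\<^bsub>A\<^esub> Mult T (fst X)"
  by (simp add: is_algebra_def case_prod_beta)

lemma category_Alg:
  assumes "is_functor A A (Endo T)"
  shows "category (Alg A T)"
proof -
  interpret T: is_functor A A "Endo T" by (rule assms)
  show ?thesis
  proof
    fix u assume "u \<in> Arr (Alg A T)"
    then show "Dom (Alg A T) u \<in> Obj (Alg A T)" "Cod (Alg A T) u \<in> Obj (Alg A T)"
      by (auto simp: Alg_def)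
  next
    fix X assume "X \<in> Obj (Alg A T)"
    then have X: "is_algebra A T X" by (simp add: Alg_simps)
    then have x: "fst X \<in> Obj A" "snd X \<in> hom A (OMap (Endo T) (fst X)) (fst X)"
      by (auto simp: is_algebra_iff)
    show "Id (Alg A T) X \<in> hom (Alg A T) X X"
      using X x T.A.id_hom[OF x(1)] T.A.id_comp[OF x(2)] T.A.comp_id[OF x(2)]
      by (simp add: hom_Alg_iff Alg_simps T.map_id)
  next
    fix u v X Y Z assume "u \<in> hom (Alg A T) X Y" "v \<in> hom (Alg A T) Y Z"
    then obtain h k where h: "u = (X, h, Y)" "h \<in> hom A (fst X) (fst Y)"
        "h \<cdot>\<^bsub>A\<^esub> snd X = snd Y \<cdot>\<^bsub>A\<^esub> AMap (Endo T) h"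
      and k: "v = (Y, k, Z)" "k \<in> hom A (fst Y) (fst Z)"
        "k \<cdot>\<^bsub>A\<^esub> snd Y = snd Z \<cdot>\<^bsub>A\<^esub> AMap (Endo T) k"
      and XYZ: "is_algebra A T X" "is_algebra A T Y" "is_algebra A T Z"
      by (auto simp: hom_Alg_iff)
    have x: "snd X \<in> hom A (OMap (Endo T) (fst X)) (fst X)"
      and y: "snd Y \<in> hom A (OMap (Endo T) (fst Y)) (fst Y)"
      and z: "snd Z \<in> hom A (OMap (Endo T) (fst Z)) (fst Z)"
      using XYZ by (auto simp: is_algebra_iff)
    have "(k \<cdot>\<^bsub>A\<^esub> h) \<cdot>\<^bsub>A\<^esub> snd X = k \<cdot>\<^bsub>A\<^esub> (snd Y \<cdot>\<^bsub>A\<^esub> AMap (Endo T) h)"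
      using T.A.comp_assoc[OF x h(2) k(2)] h(3) by simp
    also have "\<dots> = (snd Z \<cdot>\<^bsub>A\<^esub> AMap (Endo T) k) \<cdot>\<^bsub>A\<^esub> AMap (Endo T) h"
      using T.A.comp_assoc[OF T.map_hom[OF h(2)] y k(2)] k(3) by simp
    also have "\<dots> = snd Z \<cdot>\<^bsub>A\<^esub> AMap (Endo T) (k \<cdot>\<^bsub>A\<^esub> h)"
      using T.A.comp_assoc[OF T.map_hom[OF h(2)] T.map_hom[OF k(2)] z] T.map_comp[OF h(2) k(2)] by simp
    finally show "v \<cdot>\<^bsub>Alg A T\<^esub> u \<in> hom (Alg A T) X Z"
      using h k XYZ T.A.comp_hom[OF h(2) k(2)] by (simp add: hom_Alg_iff Alg_simps)
  next
    fix u X Y assume "u \<in> hom (Alg A T) X Y"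
    then show "Id (Alg A T) Y \<cdot>\<^bsub>Alg A T\<^esub> u = u" "u \<cdot>\<^bsub>Alg A T\<^esub> Id (Alg A T) X = u"
      by (auto simp: hom_Alg_iff Alg_simps T.A.id_comp T.A.comp_id)
  next
    fix u v w X Y Z W
    assume "u \<in> hom (Alg A T) X Y" "v \<in> hom (Alg A T) Y Z" "w \<in> hom (Alg A T) Z W"
    then show "w \<cdot>\<^bsub>Alg A T\<^esub> v \<cdot>\<^bsub>Alg A T\<^esub> u = w \<cdot>\<^bsub>Alg A T\<^esub> (v \<cdot>\<^bsub>Alg A T\<^esub> u)"
      by (auto simp: hom_Alg_iff Alg_simps T.A.comp_assoc)
  qed
qed

text \<open>An inverse \<open>k\<close> of the underlying arrow is automatically an algebra map.
  Writing X and Y for the structure maps, k Y = k Y T(h k) = k h X T(k) = X T(k).\<close>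

lemma is_iso_Alg:
  assumes "is_functor A A (Endo T)"
    and u: "(X, h, Y) \<in> hom (Alg A T) X Y"
    and k: "k \<in> hom A (fst Y) (fst X)" "k \<cdot>\<^bsub>A\<^esub> h = Id A (fst X)" "h \<cdot>\<^bsub>A\<^esub> k = Id A (fst Y)"
  shows "is_iso (Alg A T) (X, h, Y)"
proof -
  interpret T: is_functor A A "Endo T" by (rule assms)
  have h: "h \<in> hom A (fst X) (fst Y)" "h \<cdot>\<^bsub>A\<^esub> snd X = snd Y \<cdot>\<^bsub>A\<^esub> AMap (Endo T) h"
    and XY: "is_algebra A T X" "is_algebra A T Y"
    using u by (auto simp: hom_Alg_iff)
  have x: "snd X \<in> hom A (OMap (Endo T) (fst X)) (fst X)"
    and y: "fst Y \<in> Obj A" "snd Y \<in> hom A (OMap (Endo T) (fst Y)) (fst Y)"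
    using XY by (auto simp: is_algebra_iff)
  note Th = T.map_hom[OF h(1)] and Tk = T.map_hom[OF k(1)]
  have "k \<cdot>\<^bsub>A\<^esub> snd Y = k \<cdot>\<^bsub>A\<^esub> (snd Y \<cdot>\<^bsub>A\<^esub> AMap (Endo T) (h \<cdot>\<^bsub>A\<^esub> k))"
    using T.A.comp_id[OF y(2)] y(1) by (simp add: k T.map_id)
  also have "\<dots> = k \<cdot>\<^bsub>A\<^esub> ((h \<cdot>\<^bsub>A\<^esub> snd X) \<cdot>\<^bsub>A\<^esub> AMap (Endo T) k)"
    using T.A.comp_assoc[OF Tk Th y(2)] by (simp add: h(2) T.map_comp[OF k(1) h(1)])
  also have "\<dots> = (k \<cdot>\<^bsub>A\<^esub> h) \<cdot>\<^bsub>A\<^esub> (snd X \<cdot>\<^bsub>A\<^esub> AMap (Endo T) k)"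
    using T.A.comp_assoc[OF T.A.comp_hom[OF Tk x] h(1) k(1)] T.A.comp_assoc[OF Tk x h(1)] by simp
  also have "\<dots> = snd X \<cdot>\<^bsub>A\<^esub> AMap (Endo T) k"
    using T.A.id_comp[OF T.A.comp_hom[OF Tk x]] by (simp add: k)
  finally have "(Y, k, X) \<in> hom (Alg A T) Y X"
    using XY k(1) by (simp add: hom_Alg_iff)
  then show ?thesis
    by (rule is_isoI[OF u]) (simp_all add: Alg_simps k)
qed

text \<open>The unit law of the algebra on \<open>R y\<close> is a triangle identity, its
  associativity is naturality of \<open>\<epsilon>\<close> at the arrow \<open>\<epsilon> y\<close>,
  and compatibility of \<open>AMap R f\<close> with the structure maps is naturality of
  \<open>\<epsilon>\<close> at \<open>f\<close>.\<close>

lemma (in adjunction) comparison_functor: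
  "is_functor B (Alg A (induced_monad L R \<eta> \<epsilon>)) (comparison B R \<epsilon>)"
proof -
  let ?T = "induced_monad L R \<eta> \<epsilon>" and ?K = "comparison B R \<epsilon>"
  have T: "is_functor A A (Endo ?T)"
    unfolding induced_monad_def using unit.G.is_functor_axioms by simp
  interpret T: category "Alg A ?T" by (rule category_Alg[OF T])
  have O: "OMap ?K y = (OMap R y, AMap R (\<epsilon> y))" for y
    by (simp add: comparison_def Let_def)
  have M: "AMap ?K f = (OMap ?K x, AMap R f, OMap ?K y)" if "f \<in> hom B x y" for f x y
    using that by (simp add: comparison_def Let_def hom_def)
  have eps: "\<epsilon> y \<in> hom B (OMap L (OMap R y)) y" if "y \<in> Obj B" for y
    using counit.component[OF that] by (simp add: comp_ftor_def id_ftor_def)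
  have nat: "\<epsilon> y \<cdot>\<^bsub>B\<^esub> AMap L (AMap R f) = f \<cdot>\<^bsub>B\<^esub> \<epsilon> x" if "f \<in> hom B x y" for f x y
    using counit.naturality[OF that] by (simp add: comp_ftor_def id_ftor_def)
  have alg: "is_algebra A ?T (OMap ?K y)" if y: "y \<in> Obj B" for y
    using y R.map_obj[OF y] R.map_hom[OF eps[OF y]] triangle_right[OF y] nat[OF eps[OF y]]
      R.map_comp[OF L.map_hom[OF R.map_hom[OF eps[OF y]]] eps[OF y]]
      R.map_comp[OF eps[OF L.map_obj[OF R.map_obj[OF y]]] eps[OF y]]
    by (simp add: is_algebra_iff O induced_monad_def comp_ftor_def)
  show ?thesis
  proof
    fix y assume y: "y \<in> Obj B"
    then show "OMap ?K y \<in> Obj (Alg A ?T)" by (simp add: Alg_simps alg)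
    show "AMap ?K (Id B y) = Id (Alg A ?T) (OMap ?K y)"
      using M[OF L.B.id_hom[OF y]] by (simp add: Alg_simps O R.map_id y)
  next
    fix f x y assume f: "f \<in> hom B x y"
    then have xy: "x \<in> Obj B" "y \<in> Obj B" using L.B.dom_obj L.B.cod_obj by (auto simp: hom_def)
    show "AMap ?K f \<in> hom (Alg A ?T) (OMap ?K x) (OMap ?K y)"
      using alg xy R.map_hom[OF f] nat[OF f] R.map_comp[OF eps[OF xy(1)] f]
        R.map_comp[OF L.map_hom[OF R.map_hom[OF f]] eps[OF xy(2)]]
      by (simp add: M[OF f] hom_Alg_iff O induced_monad_def comp_ftor_def)
  next
    fix f g x y z assume f: "f \<in> hom B x y" and g: "g \<in> hom B y z"
    show "AMap ?K (g \<cdot>\<^bsub>B\<^esub> f) = AMap ?K g \<cdot>\<^bsub>Alg A ?T\<^esub> AMap ?K f"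
      using R.map_comp[OF f g] by (simp add: M[OF f] M[OF g] M[OF L.B.comp_hom[OF f g]] Alg_simps)
  qed
qed

section \<open>Pullbacks of enriched categories\<close>

lemma hom_VCat_iff: "f \<in> hom VCat C D \<longleftrightarrow> vfunctor f \<and> Src f = C \<and> Tgt f = D"
  by (auto simp: hom_def VCat_simps)

lemma hom_VCat_vcategory:
  assumes "f \<in> hom VCat C D"
  shows "vcategory C" "vcategory D"
  using assms by (auto simp: hom_VCat_iff vfunctor_iff)

lemma VMap_mem: "f \<in> hom VCat C D \<Longrightarrow> x \<in> VOb C \<Longrightarrow> VMap f x \<in> VOb D"
  by (auto simp: hom_VCat_iff vfunctor_iff)

lemma VMap_le:
  "f \<in> hom VCat C D \<Longrightarrow> x \<in> VOb C \<Longrightarrow> y \<in> VOb C \<Longrightarrow> VHom C x y \<le> VHom D (VMap f x) (VMap f y)"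
  by (auto simp: hom_VCat_iff vfunctor_iff)

lemma VMap_comp: "f \<in> hom VCat C D \<Longrightarrow> x \<in> VOb C \<Longrightarrow> VMap (g \<cdot>\<^bsub>VCat\<^esub> f) x = VMap g (VMap f x)"
  by (auto simp: VCat_simps compose_def hom_VCat_iff)

lemma VMap_Id: "x \<in> VOb C \<Longrightarrow> VMap (Id VCat C) x = x"
  by (simp add: VCat_simps)

lemma hom_VCat_eqI:
  assumes "f \<in> hom VCat C D" "g \<in> hom VCat C D" "\<And>x. x \<in> VOb C \<Longrightarrow> VMap f x = VMap g x"
  shows "f = g"
proof (rule vfun_eqI)
  show "VMap f = VMap g"
    using assms by (intro extensionalityI[of _ "VOb C"]) (auto simp: hom_VCat_iff vfunctor_iff PiE_iff)
qed (use assms in \<open>auto simp: hom_VCat_iff\<close>)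

lemma hom_VCatI:
  assumes "vcategory C" "vcategory D" "\<And>x. x \<in> VOb C \<Longrightarrow> \<phi> x \<in> VOb D"
    and "\<And>x y. x \<in> VOb C \<Longrightarrow> y \<in> VOb C \<Longrightarrow> VHom C x y \<le> VHom D (\<phi> x) (\<phi> y)"
  shows "\<lparr>Src = C, Tgt = D, VMap = restrict \<phi> (VOb C)\<rparr> \<in> hom VCat C D"
  using assms by (simp add: hom_VCat_iff vfunctor_iff)

text \<open>The pullbacks used by the descent monad are arbitrary chosen ones, so nothing but their
  universal property is available. It is tested here on two kinds of cones: points, which show that
  the objects are compatible pairs, and a cone with the largest possible homs, which shows that the
  homs are meets of homs.\<close>

lemma
  fixes p f :: "('u, 'v::complete_heyting) vfun"
  assumes pb: "is_pullback VCat p f q r" and p: "p \<in> hom VCat C D" and f: "f \<in> hom VCat X D"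
  shows pullback_point_ex: "x \<in> VOb C \<Longrightarrow> y \<in> VOb X \<Longrightarrow> VMap p x = VMap f y \<Longrightarrow>
      \<exists>u\<in>VOb (Src q). VMap q u = x \<and> VMap r u = y"
    and pullback_point_eq: "u \<in> VOb (Src q) \<Longrightarrow> v \<in> VOb (Src q) \<Longrightarrow> VMap q u = VMap q v \<Longrightarrow>
      VMap r u = VMap r v \<Longrightarrow> u = v"
    and pullback_VHom_ge: "u \<in> VOb (Src q) \<Longrightarrow> v \<in> VOb (Src q) \<Longrightarrow>
      VHom C (VMap q u) (VMap q v) \<sqinter> VHom X (VMap r u) (VMap r v) \<le> VHom (Src q) u v"
proof -
  let ?P = "Src q"
  have q: "q \<in> hom VCat ?P C" and r: "r \<in> hom VCat ?P X" and pq: "p \<cdot>\<^bsub>VCat\<^esub> q = f \<cdot>\<^bsub>VCat\<^esub> r"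
    using pb p f by (auto simp: is_pullback_def hom_VCat_iff VCat_simps(3))
  have univ: "\<exists>!h. h \<in> hom VCat Z ?P \<and> q \<cdot>\<^bsub>VCat\<^esub> h = s \<and> r \<cdot>\<^bsub>VCat\<^esub> h = t"
    if "s \<in> hom VCat Z C" "t \<in> hom VCat Z X" "p \<cdot>\<^bsub>VCat\<^esub> s = f \<cdot>\<^bsub>VCat\<^esub> t" for Z s t
    using pb p f that by (simp add: is_pullback_def hom_VCat_iff VCat_simps(3))
  interpret V: category "VCat :: (('u, 'v) vcat, ('u, 'v) vfun) cat" by (rule category_VCat)
  \<comment> \<open>\<open>I\<close> is the unit \<V>-category; its single object is called
    \<open>undefined\<close> only because some element of \<open>'u\<close> is required. The
    \<V>-functors \<open>c A x\<close> from \<open>I\<close> to \<open>A\<close> are exactly the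
    objects \<open>x\<close> of \<open>A\<close>.\<close>
  define I :: "('u, 'v) vcat" where "I = \<lparr>VOb = {undefined}, VHom = \<lambda>_ _. \<top>\<rparr>"
  define c where "c A x = \<lparr>Src = I, Tgt = A, VMap = restrict (\<lambda>_. x) (VOb I)\<rparr>" for A and x :: 'u
  have I: "vcategory I"
    by unfold_locales (auto simp: I_def le_one)
  have c: "c A x \<in> hom VCat I A" if "vcategory A" "x \<in> VOb A" for A x
    unfolding c_def using that I by (intro hom_VCatI) (auto simp: I_def intro: vcategory.vid)
  have cV: "VMap (c A x) z = x" if "z \<in> VOb I" for A x z
    using that by (simp add: c_def)
  have I1: "undefined \<in> VOb I" by (simp add: I_def)
  have comp_c: "g \<cdot>\<^bsub>VCat\<^esub> c A x = c B (VMap g x)" if "g \<in> hom VCat A B" "x \<in> VOb A" for g A B x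
  proof (rule hom_VCat_eqI)
    note cA = c[OF hom_VCat_vcategory(1)[OF that(1)] that(2)]
    show "g \<cdot>\<^bsub>VCat\<^esub> c A x \<in> hom VCat I B" by (rule V.comp_hom[OF cA that(1)])
    show "c B (VMap g x) \<in> hom VCat I B" by (rule c[OF hom_VCat_vcategory(2) VMap_mem]) (fact that)+
    show "VMap (g \<cdot>\<^bsub>VCat\<^esub> c A x) z = VMap (c B (VMap g x)) z" if "z \<in> VOb I" for z
      using that by (simp add: VMap_comp[OF cA] cV)
  qed
  have C: "vcategory C" and X: "vcategory X" and P: "vcategory ?P"
    using hom_VCat_vcategory p f q by auto
  show "\<exists>u\<in>VOb ?P. VMap q u = x \<and> VMap r u = y"
    if x: "x \<in> VOb C" and y: "y \<in> VOb X" and eq: "VMap p x = VMap f y" for x y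
  proof -
    obtain h where h: "h \<in> hom VCat I ?P" "q \<cdot>\<^bsub>VCat\<^esub> h = c C x" "r \<cdot>\<^bsub>VCat\<^esub> h = c X y"
      using univ[OF c[OF C x] c[OF X y]] comp_c[OF p x] comp_c[OF f y] eq by auto
    have "VMap q (VMap h undefined) = x" "VMap r (VMap h undefined) = y"
      unfolding VMap_comp[OF h(1) I1, symmetric] h cV[OF I1] by simp_all
    then show ?thesis using VMap_mem[OF h(1) I1] by blast
  qed
  have point_eq: "u = v" if u: "u \<in> VOb ?P" and v: "v \<in> VOb ?P" and eq: "VMap q u = VMap q v" "VMap r u = VMap r v" for u v
  proof -
    note cu = c[OF P u] and cv = c[OF P v]
    have "p \<cdot>\<^bsub>VCat\<^esub> (q \<cdot>\<^bsub>VCat\<^esub> c ?P u) = f \<cdot>\<^bsub>VCat\<^esub> (r \<cdot>\<^bsub>VCat\<^esub> c ?P u)"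
      using V.comp_assoc[OF cu q p] V.comp_assoc[OF cu r f] pq by simp
    from univ[OF V.comp_hom[OF cu q] V.comp_hom[OF cu r] this]
    have "c ?P u = c ?P v"
      using cu cv comp_c[OF q u] comp_c[OF q v] comp_c[OF r u] comp_c[OF r v] eq by auto
    then show ?thesis using cV[OF I1] by metis
  qed
  then show "u \<in> VOb ?P \<Longrightarrow> v \<in> VOb ?P \<Longrightarrow> VMap q u = VMap q v \<Longrightarrow> VMap r u = VMap r v \<Longrightarrow> u = v"
    for u v .
  text \<open>\<open>W\<close> has the largest homs making both projections \<open>\<V>\<close>-functors; the arrow it induces into the
    pullback is the identity on objects.\<close>
  define W where "W = \<lparr>VOb = VOb ?P,
    VHom = \<lambda>u v. VHom C (VMap q u) (VMap q v) \<sqinter> VHom X (VMap r u) (VMap r v)\<rparr>"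
  have W: "vcategory W"
  proof
    fix u assume "u \<in> VOb W"
    then show "\<top> \<le> VHom W u u"
      using VMap_mem[OF q] VMap_mem[OF r] C X by (auto simp: W_def intro!: meet_greatest vcategory.vid)
  next
    fix u v w assume "u \<in> VOb W" "v \<in> VOb W" "w \<in> VOb W"
    then have *: "u \<in> VOb ?P" "v \<in> VOb ?P" "w \<in> VOb ?P" by (auto simp: W_def)
    have "VHom W v w \<sqinter> VHom W u v \<le> VHom C (VMap q v) (VMap q w) \<sqinter> VHom C (VMap q u) (VMap q v)"
      by (auto simp: W_def intro: meet_mono meet_le1)
    also have "\<dots> \<le> VHom C (VMap q u) (VMap q w)"
      using * VMap_mem[OF q] by (intro vcategory.vcomp[OF C]) auto
    finally have 1: "VHom W v w \<sqinter> VHom W u v \<le> VHom C (VMap q u) (VMap q w)" .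
    have "VHom W v w \<sqinter> VHom W u v \<le> VHom X (VMap r v) (VMap r w) \<sqinter> VHom X (VMap r u) (VMap r v)"
      by (auto simp: W_def intro: meet_mono meet_le2)
    also have "\<dots> \<le> VHom X (VMap r u) (VMap r w)"
      using * VMap_mem[OF r] by (intro vcategory.vcomp[OF X]) auto
    finally show "VHom W v w \<sqinter> VHom W u v \<le> VHom W u w"
      using 1 by (auto simp: W_def intro: meet_greatest)
  qed
  have VW: "VOb W = VOb ?P" by (simp add: W_def)
  define s where "s = \<lparr>Src = W, Tgt = C, VMap = restrict (VMap q) (VOb W)\<rparr>"
  define t where "t = \<lparr>Src = W, Tgt = X, VMap = restrict (VMap r) (VOb W)\<rparr>"
  have s: "s \<in> hom VCat W C" and t: "t \<in> hom VCat W X"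
    unfolding s_def t_def using W C X VMap_mem[OF q] VMap_mem[OF r]
    by (intro hom_VCatI; auto simp: W_def intro: meet_le1 meet_le2)+
  have "p \<cdot>\<^bsub>VCat\<^esub> s = f \<cdot>\<^bsub>VCat\<^esub> t"
  proof (rule hom_VCat_eqI[OF V.comp_hom[OF s p] V.comp_hom[OF t f]])
    fix w assume w: "w \<in> VOb W"
    have "VMap p (VMap q w) = VMap f (VMap r w)"
      using w pq VMap_comp[OF q] VMap_comp[OF r] by (metis VW)
    then show "VMap (p \<cdot>\<^bsub>VCat\<^esub> s) w = VMap (f \<cdot>\<^bsub>VCat\<^esub> t) w"
      using w by (simp add: VMap_comp[OF s] VMap_comp[OF t]) (simp add: s_def t_def)
  qed
  then obtain h where h: "h \<in> hom VCat W ?P" "q \<cdot>\<^bsub>VCat\<^esub> h = s" "r \<cdot>\<^bsub>VCat\<^esub> h = t"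
    using univ[OF s t] by auto
  have hu: "VMap h u = u" if u: "u \<in> VOb ?P" for u
  proof (rule point_eq)
    have uW: "u \<in> VOb W" using u VW by simp
    show "VMap h u \<in> VOb ?P" by (rule VMap_mem[OF h(1) uW])
    show "VMap q (VMap h u) = VMap q u" "VMap r (VMap h u) = VMap r u"
      using VMap_comp[OF h(1) uW, of q] VMap_comp[OF h(1) uW, of r] h uW by (simp_all add: s_def t_def)
  qed (rule u)
  show "VHom C (VMap q u) (VMap q v) \<sqinter> VHom X (VMap r u) (VMap r v) \<le> VHom ?P u v"
    if "u \<in> VOb ?P" "v \<in> VOb ?P" for u v
    using VMap_le[OF h(1), of u v] that hu by (simp add: W_def)
qed

text \<open>The witness is the Heyting implication from \<open>b\<close> to \<open>a\<close>. It is
  the device by which meets are carried past joins below: a bound on a join met with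
  \<open>b\<close> becomes a bound on the join alone.\<close>

lemma meet_adjoint:
  fixes a b :: "'v::complete_heyting"
  shows "\<exists>r. \<forall>x. x \<sqinter> b \<le> a \<longleftrightarrow> x \<le> r"
proof -
  from meet_right_adjoint[of b] obtain r where r: "\<forall>x c. b \<sqinter> x \<le> c \<longleftrightarrow> x \<le> r c" ..
  \<comment> \<open>In a preorder the chosen meet is commutative only up to isomorphism, so the two
    sides are exchanged by inequalities.\<close>
  have "x \<sqinter> b \<le> b \<sqinter> x" "b \<sqinter> x \<le> x \<sqinter> b" for x
    by (auto intro: meet_greatest meet_le1 meet_le2)
  then have "x \<sqinter> b \<le> a \<longleftrightarrow> b \<sqinter> x \<le> a" for x
    by (meson order_trans)
  then show ?thesis using r by blast
qed

lemma meet_commute_le: "a \<sqinter> b \<le> b \<sqinter> (a :: 'v::complete_heyting)"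
  by (intro meet_greatest meet_le1 meet_le2)

section \<open>Descent along a functor covering composable pairs\<close>

text \<open>\<open>composable_pairs_le\<close> says that pairs in \<open>D\<close> lie below the
  join of the pairs of lifts in \<open>C\<close>, with the join replaced by an arbitrary upper bound
  \<open>a\<close>, so that it can be applied as an elimination rule.\<close>

locale descent_vfunctor =
  fixes p :: "('u::infinite, 'v::complete_heyting) vfun" and C D
  assumes p: "p \<in> hom VCat C D"
    and surj: "y \<in> VOb D \<Longrightarrow> \<exists>x\<in>VOb C. VMap p x = y"
    and composable_pairs_le: "y0 \<in> VOb D \<Longrightarrow> y1 \<in> VOb D \<Longrightarrow> y2 \<in> VOb D \<Longrightarrow>
      (\<And>x0 x1 x2. x0 \<in> VOb C \<Longrightarrow> x1 \<in> VOb C \<Longrightarrow> x2 \<in> VOb C \<Longrightarrow> VMap p x0 = y0 \<Longrightarrow>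
        VMap p x1 = y1 \<Longrightarrow> VMap p x2 = y2 \<Longrightarrow> VHom C x1 x2 \<sqinter> VHom C x0 x1 \<le> a) \<Longrightarrow>
      VHom D y1 y2 \<sqinter> VHom D y0 y1 \<le> a"
begin

sublocale V: category_with_pullbacks "VCat :: (('u, 'v) vcat, ('u, 'v) vfun) cat"
  by (rule pullbacks_VCat)

abbreviation "T \<equiv> descent_monad VCat p"
abbreviation "E \<equiv> slice VCat C :: (('u, 'v) vfun, ('u, 'v) vfun \<times> ('u, 'v) vfun \<times> ('u, 'v) vfun) cat"
abbreviation "B \<equiv> slice VCat D :: (('u, 'v) vfun, ('u, 'v) vfun \<times> ('u, 'v) vfun \<times> ('u, 'v) vfun) cat"
abbreviation "R \<equiv> pullback_ftor VCat p"
abbreviation "\<pi>1 f \<equiv> pb1 VCat p f"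
abbreviation "\<pi>2 f \<equiv> pb2 VCat p f"
abbreviation "P f \<equiv> Src (pb1 VCat p f)"
abbreviation "K \<equiv> comparison B R (descent_counit VCat p)"

text \<open>A single arrow y0 \<rightarrow> y1 is a composable pair whose first member is the
  identity of \<open>y0\<close>; its lift is a pair x0 \<rightarrow> x1 \<rightarrow> x2, of which
  only the second arrow is kept. The extra factor \<open>b\<close> is absorbed into the bound by the
  implication \<open>r\<close>.\<close>

lemma VHom_le_of_lifts:
  assumes y: "y0 \<in> VOb D" "y1 \<in> VOb D"
    and *: "\<And>x0 x1. x0 \<in> VOb C \<Longrightarrow> x1 \<in> VOb C \<Longrightarrow> VMap p x0 = y0 \<Longrightarrow> VMap p x1 = y1 \<Longrightarrow>
      VHom C x0 x1 \<sqinter> b \<le> a"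
  shows "VHom D y0 y1 \<sqinter> b \<le> a"
proof -
  have D: "vcategory D" using p by (rule hom_VCat_vcategory)
  from meet_adjoint[of b a] obtain r where r: "\<forall>x. x \<sqinter> b \<le> a \<longleftrightarrow> x \<le> r" ..
  have "VHom D y0 y1 \<sqinter> VHom D y0 y0 \<le> r"
  proof (rule composable_pairs_le[OF y(1,1,2)])
    fix x0 x1 x2 assume "x0 \<in> VOb C" "x1 \<in> VOb C" "x2 \<in> VOb C" "VMap p x0 = y0" "VMap p x1 = y0" "VMap p x2 = y1"
    then have "VHom C x1 x2 \<le> r" using * r by simp
    with meet_le1 show "VHom C x1 x2 \<sqinter> VHom C x0 x1 \<le> r" by (rule order_trans)
  qed
  moreover have "VHom D y0 y1 \<le> VHom D y0 y1 \<sqinter> VHom D y0 y0"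
    using order_trans[OF le_one vcategory.vid[OF D y(1)]] by (intro meet_greatest order_refl)
  ultimately show ?thesis using r order_trans by blast
qed

section \<open>Slices of \<open>VCat\<close> and the pullback functor, described on objects\<close>

lemma Obj_B_iff: "f \<in> Obj B \<longleftrightarrow> f \<in> hom VCat (Src f) D"
  by (auto simp: slice_simps hom_VCat_iff VCat_simps)

lemma Obj_E_iff: "g \<in> Obj E \<longleftrightarrow> g \<in> hom VCat (Src g) C"
  by (auto simp: slice_simps hom_VCat_iff VCat_simps)

lemma hom_B_iff: "(f, h, g) \<in> hom B f g \<longleftrightarrow> f \<in> Obj B \<and> g \<in> Obj B \<and> h \<in> hom VCat (Src f) (Src g) \<and>
    (\<forall>x\<in>VOb (Src f). VMap g (VMap h x) = VMap f x)" (is "?l \<longleftrightarrow> ?r")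
proof
  assume ?l then show ?r
    by (auto simp: hom_slice_iff slice_simps VCat_simps(2-4) VMap_comp[symmetric])
next
  assume r: ?r
  then have "g \<cdot>\<^bsub>VCat\<^esub> h = f"
    by (intro hom_VCat_eqI[of _ "Src f" D]) (auto simp: Obj_B_iff VMap_comp intro: V.comp_hom)
  with r show ?l by (auto simp: hom_slice_iff slice_simps VCat_simps(2-4))
qed

lemma hom_E_iff: "(f, h, g) \<in> hom E f g \<longleftrightarrow> f \<in> Obj E \<and> g \<in> Obj E \<and> h \<in> hom VCat (Src f) (Src g) \<and>
    (\<forall>x\<in>VOb (Src f). VMap g (VMap h x) = VMap f x)" (is "?l \<longleftrightarrow> ?r")
proof
  assume ?l then show ?r
    by (auto simp: hom_slice_iff slice_simps VCat_simps(2-4) VMap_comp[symmetric])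
next
  assume r: ?r
  then have "g \<cdot>\<^bsub>VCat\<^esub> h = f"
    by (intro hom_VCat_eqI[of _ "Src f" C]) (auto simp: Obj_E_iff VMap_comp intro: V.comp_hom)
  with r show ?l by (auto simp: hom_slice_iff slice_simps VCat_simps(2-4))
qed

lemma p_comp: "g \<in> Obj E \<Longrightarrow> p \<cdot>\<^bsub>VCat\<^esub> g \<in> Obj B" "Src (p \<cdot>\<^bsub>VCat\<^esub> g) = Src g"
  "g \<in> Obj E \<Longrightarrow> z \<in> VOb (Src g) \<Longrightarrow> VMap (p \<cdot>\<^bsub>VCat\<^esub> g) z = VMap p (VMap g z)"
proof -
  show S: "Src (p \<cdot>\<^bsub>VCat\<^esub> g) = Src g" by (simp add: VCat_simps)
  show "p \<cdot>\<^bsub>VCat\<^esub> g \<in> Obj B" if "g \<in> Obj E"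
    using that V.comp_hom[of g _ C p, OF _ p] by (simp add: Obj_B_iff Obj_E_iff S)
  show "VMap (p \<cdot>\<^bsub>VCat\<^esub> g) z = VMap p (VMap g z)" if "g \<in> Obj E" "z \<in> VOb (Src g)"
    using that VMap_comp by (auto simp: Obj_E_iff)
qed

context
  fixes f assumes f: "f \<in> Obj B"
begin

lemma pb_f: "is_pullback VCat p f (\<pi>1 f) (\<pi>2 f)"
  using V.pb_is_pullback[of p f] p f by (simp add: hom_VCat_iff Obj_B_iff VCat_simps(2-4))

lemma \<pi>_hom: "\<pi>1 f \<in> hom VCat (P f) C" "\<pi>2 f \<in> hom VCat (P f) (Src f)"
  using pb_f p by (auto simp: is_pullback_def hom_VCat_iff VCat_simps(3))

lemma \<pi>1_Obj: "\<pi>1 f \<in> Obj E" using \<pi>_hom by (simp add: Obj_E_iff)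

lemma \<pi>_mem:
  assumes "u \<in> VOb (P f)"
  shows "VMap (\<pi>1 f) u \<in> VOb C" "VMap (\<pi>2 f) u \<in> VOb (Src f)"
    "VMap p (VMap (\<pi>1 f) u) = VMap f (VMap (\<pi>2 f) u)"
proof -
  show "VMap (\<pi>1 f) u \<in> VOb C" "VMap (\<pi>2 f) u \<in> VOb (Src f)"
    using VMap_mem[OF _ assms] \<pi>_hom by blast+
  have "p \<cdot>\<^bsub>VCat\<^esub> \<pi>1 f = f \<cdot>\<^bsub>VCat\<^esub> \<pi>2 f" using pb_f by (simp add: is_pullback_def)
  then show "VMap p (VMap (\<pi>1 f) u) = VMap f (VMap (\<pi>2 f) u)"
    using VMap_comp[OF \<pi>_hom(1) assms, of p] VMap_comp[OF \<pi>_hom(2) assms, of f] by simp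
qed

lemmas \<pi>_le = VMap_le[OF \<pi>_hom(1)] VMap_le[OF \<pi>_hom(2)]
lemmas point_ex = pullback_point_ex[OF pb_f p f[unfolded Obj_B_iff]]
lemmas point_eq = pullback_point_eq[OF pb_f p f[unfolded Obj_B_iff]]
lemmas P_ge = pullback_VHom_ge[OF pb_f p f[unfolded Obj_B_iff]]

end

lemma R_map:
  assumes "(f, h, g) \<in> hom B f g"
  obtains k where "AMap R (f, h, g) = (\<pi>1 f, k, \<pi>1 g)" "k \<in> hom VCat (P f) (P g)"
    "\<And>u. u \<in> VOb (P f) \<Longrightarrow> VMap (\<pi>1 g) (VMap k u) = VMap (\<pi>1 f) u"
    "\<And>u. u \<in> VOb (P f) \<Longrightarrow> VMap (\<pi>2 g) (VMap k u) = VMap h (VMap (\<pi>2 f) u)"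
proof -
  have p': "p \<in> Arr VCat" "Cod VCat p = D" using p by (auto simp: hom_def)
  have f: "f \<in> Obj B" using assms by (simp add: hom_B_iff)
  obtain k where k: "AMap R (f, h, g) = (\<pi>1 f, k, \<pi>1 g)" "k \<in> hom VCat (P f) (P g)"
      "\<pi>1 g \<cdot>\<^bsub>VCat\<^esub> k = \<pi>1 f" "\<pi>2 g \<cdot>\<^bsub>VCat\<^esub> k = h \<cdot>\<^bsub>VCat\<^esub> \<pi>2 f"
    using V.pullback_map'[OF p'(1), of f h g] assms p'(2) by (auto simp: VCat_simps(3))
  show thesis
    by (rule that[OF k(1,2)]; simp add: VMap_comp[OF k(2), symmetric] k VMap_comp[OF \<pi>_hom(2)[OF f]])
qed

lemma Endo_T: "OMap (Endo T) g = \<pi>1 (p \<cdot>\<^bsub>VCat\<^esub> g)"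
  "AMap (Endo T) (g, h, g') = AMap R (p \<cdot>\<^bsub>VCat\<^esub> g, h, p \<cdot>\<^bsub>VCat\<^esub> g')"
  by (simp_all add: descent_monad_def induced_monad_def comp_ftor_def postcomp_ftor_def pullback_ftor_def)

lemma adj: "adjunction E B (postcomp_ftor VCat p) R (descent_unit VCat p) (descent_counit VCat p)"
  using V.pullback_adjunction[of p] p by (simp add: hom_VCat_iff VCat_simps(2-4))

lemma Endo_functor: "is_functor E E (Endo T)"
proof -
  interpret adjunction E B "postcomp_ftor VCat p" R "descent_unit VCat p" "descent_counit VCat p"
    by (rule adj)
  show ?thesis
    unfolding descent_monad_def induced_monad_def using unit.G.is_functor_axioms by simp
qed

lemma K_functor: "is_functor B (Alg E T) K"
  using adjunction.comparison_functor[OF adj] by (simp add: descent_monad_def)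

lemma counit_hom:
  assumes "f \<in> Obj B"
  shows "descent_counit VCat p f = (p \<cdot>\<^bsub>VCat\<^esub> \<pi>1 f, \<pi>2 f, f)"
    "(p \<cdot>\<^bsub>VCat\<^esub> \<pi>1 f, \<pi>2 f, f) \<in> hom B (p \<cdot>\<^bsub>VCat\<^esub> \<pi>1 f) f"
  using assms \<pi>1_Obj[OF assms] \<pi>_hom[OF assms] \<pi>_mem[OF assms]
  by (auto simp: descent_counit_def hom_B_iff p_comp)

lemma K_simps:
  "OMap K f = (\<pi>1 f, AMap R (descent_counit VCat p f))"
  "(f, h, g) \<in> hom B f g \<Longrightarrow> AMap K (f, h, g) = (OMap K f, AMap R (f, h, g), OMap K g)"
  by (auto simp: comparison_def Let_def pullback_ftor_def hom_def)

lemma T_map: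
  assumes "(g, h, g') \<in> hom E g g'"
  obtains k where "AMap (Endo T) (g, h, g') = (\<pi>1 (p \<cdot>\<^bsub>VCat\<^esub> g), k, \<pi>1 (p \<cdot>\<^bsub>VCat\<^esub> g'))"
    "k \<in> hom VCat (P (p \<cdot>\<^bsub>VCat\<^esub> g)) (P (p \<cdot>\<^bsub>VCat\<^esub> g'))"
    "\<And>w. w \<in> VOb (P (p \<cdot>\<^bsub>VCat\<^esub> g)) \<Longrightarrow>
      VMap (\<pi>1 (p \<cdot>\<^bsub>VCat\<^esub> g')) (VMap k w) = VMap (\<pi>1 (p \<cdot>\<^bsub>VCat\<^esub> g)) w"
    "\<And>w. w \<in> VOb (P (p \<cdot>\<^bsub>VCat\<^esub> g)) \<Longrightarrow>
      VMap (\<pi>2 (p \<cdot>\<^bsub>VCat\<^esub> g')) (VMap k w) = VMap h (VMap (\<pi>2 (p \<cdot>\<^bsub>VCat\<^esub> g)) w)"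
proof -
  have "(p \<cdot>\<^bsub>VCat\<^esub> g, h, p \<cdot>\<^bsub>VCat\<^esub> g') \<in> hom B (p \<cdot>\<^bsub>VCat\<^esub> g) (p \<cdot>\<^bsub>VCat\<^esub> g')"
    using assms by (auto simp: hom_E_iff hom_B_iff p_comp VMap_mem)
  from R_map[OF this] show thesis using that unfolding Endo_T by blast
qed

text \<open>This is the quotient property of \<open>\<pi>2 f\<close> on homs. An arrow y0
  \<rightarrow> y1 has an image in \<open>D\<close>, that image is covered by arrows x0
  \<rightarrow> x1 of \<open>C\<close>, and such an arrow paired with y0 \<rightarrow> y1 is an
  arrow of the pullback lying over y0 \<rightarrow> y1.\<close>

lemma \<pi>2_VHom_le:
  assumes f: "f \<in> Obj B" and y: "y0 \<in> VOb (Src f)" "y1 \<in> VOb (Src f)"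
    and *: "\<And>u0 u1. u0 \<in> VOb (P f) \<Longrightarrow> u1 \<in> VOb (P f) \<Longrightarrow> VMap (\<pi>2 f) u0 = y0 \<Longrightarrow>
      VMap (\<pi>2 f) u1 = y1 \<Longrightarrow> VHom (P f) u0 u1 \<le> a"
  shows "VHom (Src f) y0 y1 \<le> a"
proof -
  note f' = f[unfolded Obj_B_iff]
  have "VHom (Src f) y0 y1 \<le> VHom D (VMap f y0) (VMap f y1) \<sqinter> VHom (Src f) y0 y1"
    by (intro meet_greatest VMap_le[OF f' y] order_refl)
  also have "\<dots> \<le> a"
  proof (rule VHom_le_of_lifts[OF VMap_mem[OF f' y(1)] VMap_mem[OF f' y(2)]])
    fix x0 x1 assume x: "x0 \<in> VOb C" "x1 \<in> VOb C" "VMap p x0 = VMap f y0" "VMap p x1 = VMap f y1"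
    obtain u0 where u0: "u0 \<in> VOb (P f)" "VMap (\<pi>1 f) u0 = x0" "VMap (\<pi>2 f) u0 = y0"
      using point_ex[OF f x(1) y(1) x(3)] by blast
    obtain u1 where u1: "u1 \<in> VOb (P f)" "VMap (\<pi>1 f) u1 = x1" "VMap (\<pi>2 f) u1 = y1"
      using point_ex[OF f x(2) y(2) x(4)] by blast
    show "VHom C x0 x1 \<sqinter> VHom (Src f) y0 y1 \<le> a"
      using P_ge[OF f u0(1) u1(1)] *[OF u0(1) u1(1) u0(3) u1(3)] order_trans unfolding u0 u1 by blast
  qed
  finally show ?thesis .
qed

lemma \<pi>2_surj:
  assumes f: "f \<in> Obj B" and y: "y \<in> VOb (Src f)"
  shows "\<exists>u\<in>VOb (P f). VMap (\<pi>2 f) u = y"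
  using surj[OF VMap_mem[OF f[unfolded Obj_B_iff] y]] point_ex[OF f _ y] by blast

section \<open>Full faithfulness of the comparison functor\<close>

lemma K_faithful:
  assumes u: "u \<in> hom B f g" and v: "v \<in> hom B f g" and eq: "AMap K u = AMap K v"
  shows "u = v"
proof -
  obtain h h' where uv: "u = (f, h, g)" "v = (f, h', g)"
    using u v by (auto simp: hom_slice_iff)
  note h = u[unfolded uv] and h' = v[unfolded uv]
  obtain k where k: "AMap R (f, h, g) = (\<pi>1 f, k, \<pi>1 g)" 
    "\<And>u. u \<in> VOb (P f) \<Longrightarrow> VMap (\<pi>2 g) (VMap k u) = VMap h (VMap (\<pi>2 f) u)"
    using R_map[OF h] by metis
  obtain k' where k': "AMap R (f, h', g) = (\<pi>1 f, k', \<pi>1 g)" 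
    "\<And>u. u \<in> VOb (P f) \<Longrightarrow> VMap (\<pi>2 g) (VMap k' u) = VMap h' (VMap (\<pi>2 f) u)"
    using R_map[OF h'] by metis
  have kk: "k = k'" using eq by (simp add: uv K_simps(2)[OF h] K_simps(2)[OF h'] k k')
  have f: "f \<in> Obj B" using h by (simp add: hom_B_iff)
  \<comment> \<open>\<open>h\<close> after \<open>\<pi>2 f\<close> equals \<open>\<pi>2 g\<close>
    after \<open>k\<close>, and \<open>\<pi>2 f\<close> is surjective on objects, so
    \<open>k\<close> determines \<open>h\<close>.\<close>
  have "h = h'"
  proof (rule hom_VCat_eqI)
    show "h \<in> hom VCat (Src f) (Src g)" "h' \<in> hom VCat (Src f) (Src g)"
      using h h' by (simp_all add: hom_B_iff)
    show "VMap h y = VMap h' y" if "y \<in> VOb (Src f)" for y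
      using \<pi>2_surj[OF f that] k(2) k'(2) kk by metis
  qed
  then show ?thesis by (simp add: uv)
qed

text \<open>The canonical action on a pulled-back object. With \<open>w\<close> read as a pair (x,
  (x', y)), it forgets x' and yields (x, y).\<close>

lemma K_action:
  assumes f: "f \<in> Obj B"
  obtains k where "snd (OMap K f) = (\<pi>1 (p \<cdot>\<^bsub>VCat\<^esub> \<pi>1 f), k, \<pi>1 f)"
    "k \<in> hom VCat (P (p \<cdot>\<^bsub>VCat\<^esub> \<pi>1 f)) (P f)"
    "\<And>w. w \<in> VOb (P (p \<cdot>\<^bsub>VCat\<^esub> \<pi>1 f)) \<Longrightarrow> VMap (\<pi>1 f) (VMap k w) = VMap (\<pi>1 (p \<cdot>\<^bsub>VCat\<^esub> \<pi>1 f)) w"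
    "\<And>w. w \<in> VOb (P (p \<cdot>\<^bsub>VCat\<^esub> \<pi>1 f)) \<Longrightarrow>
      VMap (\<pi>2 f) (VMap k w) = VMap (\<pi>2 f) (VMap (\<pi>2 (p \<cdot>\<^bsub>VCat\<^esub> \<pi>1 f)) w)"
  using R_map[OF counit_hom(2)[OF f]] unfolding K_simps snd_conv counit_hom(1)[OF f] by metis

lemma K_full:
  assumes f: "f \<in> Obj B" and g: "g \<in> Obj B" and v: "v \<in> hom (Alg E T) (OMap K f) (OMap K g)"
  shows "\<exists>u\<in>hom B f g. AMap K u = v"
proof -
  obtain v0 where v0: "v = (OMap K f, v0, OMap K g)" "v0 \<in> hom E (\<pi>1 f) (\<pi>1 g)"
      "v0 \<cdot>\<^bsub>E\<^esub> snd (OMap K f) = snd (OMap K g) \<cdot>\<^bsub>E\<^esub> AMap (Endo T) v0"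
    using v by (auto simp: hom_Alg_iff K_simps(1))
  then obtain h where h: "v0 = (\<pi>1 f, h, \<pi>1 g)" by (auto simp: hom_slice_iff)
  note hE = v0(2)[unfolded h]
  have hh: "h \<in> hom VCat (P f) (P g)" and h1: "\<And>u. u \<in> VOb (P f) \<Longrightarrow> VMap (\<pi>1 g) (VMap h u) = VMap (\<pi>1 f) u"
    using hE by (auto simp: hom_E_iff)
  let ?pf = "p \<cdot>\<^bsub>VCat\<^esub> \<pi>1 f" and ?pg = "p \<cdot>\<^bsub>VCat\<^esub> \<pi>1 g"
  have pf: "?pf \<in> Obj B" by (rule p_comp(1)[OF \<pi>1_Obj[OF f]])
  obtain a where a: "snd (OMap K f) = (\<pi>1 ?pf, a, \<pi>1 f)" "a \<in> hom VCat (P ?pf) (P f)"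
    "\<And>w. w \<in> VOb (P ?pf) \<Longrightarrow> VMap (\<pi>1 f) (VMap a w) = VMap (\<pi>1 ?pf) w"
    "\<And>w. w \<in> VOb (P ?pf) \<Longrightarrow> VMap (\<pi>2 f) (VMap a w) = VMap (\<pi>2 f) (VMap (\<pi>2 ?pf) w)"
    using K_action[OF f] by metis
  obtain b where b: "snd (OMap K g) = (\<pi>1 ?pg, b, \<pi>1 g)" "b \<in> hom VCat (P ?pg) (P g)"
    "\<And>w. w \<in> VOb (P ?pg) \<Longrightarrow> VMap (\<pi>2 g) (VMap b w) = VMap (\<pi>2 g) (VMap (\<pi>2 ?pg) w)"
    using K_action[OF g] by metis
  obtain k where k: "AMap (Endo T) v0 = (\<pi>1 ?pf, k, \<pi>1 ?pg)" "k \<in> hom VCat (P ?pf) (P ?pg)"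
    "\<And>w. w \<in> VOb (P ?pf) \<Longrightarrow> VMap (\<pi>2 ?pg) (VMap k w) = VMap h (VMap (\<pi>2 ?pf) w)"
    using T_map[OF hE] unfolding h by metis
  have ha: "h \<cdot>\<^bsub>VCat\<^esub> a = b \<cdot>\<^bsub>VCat\<^esub> k"
    using v0(3) by (simp add: h[symmetric] k a b) (simp add: h slice_simps)
  \<comment> \<open>Two objects of \<open>P f\<close> with the same second coordinate are linked by
    the action: acting on \<open>u\<close> with the first coordinate of \<open>u'\<close> gives
    \<open>u'\<close>. Since \<open>h\<close> is equivariant and the action on \<open>P g\<close>
    preserves the second coordinate, \<open>\<pi>2 g\<close> after \<open>h\<close> is constant on
    the fibres of \<open>\<pi>2 f\<close> and so descends to \<open>Src f\<close>.\<close>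
  have const: "VMap (\<pi>2 g) (VMap h u) = VMap (\<pi>2 g) (VMap h u')"
    if u: "u \<in> VOb (P f)" "u' \<in> VOb (P f)" "VMap (\<pi>2 f) u = VMap (\<pi>2 f) u'" for u u'
  proof -
    have "VMap p (VMap (\<pi>1 f) u') = VMap ?pf u"
      using u \<pi>_mem[OF f] p_comp(3)[OF \<pi>1_Obj[OF f] u(1)] by simp
    then obtain w where w: "w \<in> VOb (P ?pf)" "VMap (\<pi>1 ?pf) w = VMap (\<pi>1 f) u'" "VMap (\<pi>2 ?pf) w = u"
      using point_ex[OF pf, of "VMap (\<pi>1 f) u'" u] u \<pi>_mem[OF f] by (auto simp: p_comp(2))
    have "VMap a w = u'"
      by (rule point_eq[OF f VMap_mem[OF a(2) w(1)] u(2)]) (simp_all add: a w u)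
    then have "VMap (\<pi>2 g) (VMap h u') = VMap (\<pi>2 g) (VMap (h \<cdot>\<^bsub>VCat\<^esub> a) w)"
      using VMap_comp[OF a(2) w(1)] by simp
    also have "\<dots> = VMap (\<pi>2 g) (VMap h u)"
      unfolding ha using VMap_comp[OF k(2) w(1)] b(3)[OF VMap_mem[OF k(2) w(1)]] k(3)[OF w(1)] w(3) by simp
    finally show ?thesis by simp
  qed
  define s where "s y = (SOME u. u \<in> VOb (P f) \<and> VMap (\<pi>2 f) u = y)" for y
  have s: "s y \<in> VOb (P f)" "VMap (\<pi>2 f) (s y) = y" if "y \<in> VOb (Src f)" for y
    using someI_ex[of "\<lambda>u. u \<in> VOb (P f) \<and> VMap (\<pi>2 f) u = y"] \<pi>2_surj[OF f that] unfolding s_def by auto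
  define l where "l = \<lparr>Src = Src f, Tgt = Src g, VMap = restrict (\<lambda>y. VMap (\<pi>2 g) (VMap h (s y))) (VOb (Src f))\<rparr>"
  have l: "l \<in> hom VCat (Src f) (Src g)"
    unfolding l_def
  proof (rule hom_VCatI)
    show "vcategory (Src f)" "vcategory (Src g)"
      using f g hom_VCat_vcategory by (auto simp: Obj_B_iff)
    show "VMap (\<pi>2 g) (VMap h (s y)) \<in> VOb (Src g)" if "y \<in> VOb (Src f)" for y
      using VMap_mem[OF \<pi>_hom(2)[OF g] VMap_mem[OF hh]] s that by blast
    fix y y' assume y: "y \<in> VOb (Src f)" "y' \<in> VOb (Src f)"
    show "VHom (Src f) y y' \<le> VHom (Src g) (VMap (\<pi>2 g) (VMap h (s y))) (VMap (\<pi>2 g) (VMap h (s y')))"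
    \<comment> \<open>It is enough to bound the homs between arbitrary lifts \<open>u\<close>,
      \<open>u'\<close>, where \<open>h\<close> is a \<V>-functor; \<open>const\<close> then
      replaces \<open>u\<close> and \<open>u'\<close> by the chosen lifts \<open>s y\<close> and
      \<open>s y'\<close>.\<close>
    proof (rule \<pi>2_VHom_le[OF f y])
      fix u u' assume u: "u \<in> VOb (P f)" "u' \<in> VOb (P f)" "VMap (\<pi>2 f) u = y" "VMap (\<pi>2 f) u' = y'"
      have "VHom (P f) u u' \<le> VHom (P g) (VMap h u) (VMap h u')"
        by (rule VMap_le[OF hh u(1,2)])
      also have "\<dots> \<le> VHom (Src g) (VMap (\<pi>2 g) (VMap h u)) (VMap (\<pi>2 g) (VMap h u'))"
        by (rule \<pi>_le(2)[OF g VMap_mem[OF hh u(1)] VMap_mem[OF hh u(2)]])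
      finally show "VHom (P f) u u' \<le>
          VHom (Src g) (VMap (\<pi>2 g) (VMap h (s y))) (VMap (\<pi>2 g) (VMap h (s y')))"
        using const[OF u(1) s(1)[OF y(1)]] const[OF u(2) s(1)[OF y(2)]] u s y by simp
    qed
  qed
  have l_eq: "VMap l (VMap (\<pi>2 f) u) = VMap (\<pi>2 g) (VMap h u)" if "u \<in> VOb (P f)" for u
    using const[OF that s(1)[OF \<pi>_mem(2)[OF f that]]] s(2)[OF \<pi>_mem(2)[OF f that]] \<pi>_mem(2)[OF f that]
    by (simp add: l_def)
  have lB: "(f, l, g) \<in> hom B f g"
  proof -
    have "VMap g (VMap l y) = VMap f y" if y: "y \<in> VOb (Src f)" for y
    proof -
      obtain u where u: "u \<in> VOb (P f)" "VMap (\<pi>2 f) u = y" using \<pi>2_surj[OF f y] by blast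
      have "VMap g (VMap l y) = VMap p (VMap (\<pi>1 g) (VMap h u))"
        using l_eq[OF u(1)] u(2) \<pi>_mem(3)[OF g VMap_mem[OF hh u(1)]] by simp
      also have "\<dots> = VMap f y" using h1[OF u(1)] \<pi>_mem(3)[OF f u(1)] u(2) by simp
      finally show ?thesis .
    qed
    then show ?thesis using f g l by (simp add: hom_B_iff)
  qed
  obtain m where m: "AMap R (f, l, g) = (\<pi>1 f, m, \<pi>1 g)" "m \<in> hom VCat (P f) (P g)"
    "\<And>u. u \<in> VOb (P f) \<Longrightarrow> VMap (\<pi>1 g) (VMap m u) = VMap (\<pi>1 f) u"
    "\<And>u. u \<in> VOb (P f) \<Longrightarrow> VMap (\<pi>2 g) (VMap m u) = VMap l (VMap (\<pi>2 f) u)"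
    using R_map[OF lB] by metis
  have "m = h"
  proof (rule hom_VCat_eqI[OF m(2) hh])
    fix u assume u: "u \<in> VOb (P f)"
    show "VMap m u = VMap h u"
      by (rule point_eq[OF g VMap_mem[OF m(2) u] VMap_mem[OF hh u]]) (simp_all add: m l_eq h1 u)
  qed
  then have "AMap K (f, l, g) = v"
    by (simp add: K_simps(2)[OF lB] m v0(1) h)
  then show ?thesis using lB by blast
qed


section \<open>Towards essential surjectivity: a covering rule and descent algebras as partial
  actions\<close>

lemma composable_pairs_meet_le:
  assumes y: "y0 \<in> VOb D" "y1 \<in> VOb D" "y2 \<in> VOb D"
    and *: "\<And>x0 x1 x2. x0 \<in> VOb C \<Longrightarrow> x1 \<in> VOb C \<Longrightarrow> x2 \<in> VOb C \<Longrightarrow> VMap p x0 = y0 \<Longrightarrow>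
        VMap p x1 = y1 \<Longrightarrow> VMap p x2 = y2 \<Longrightarrow> (VHom C x1 x2 \<sqinter> VHom C x0 x1) \<sqinter> b \<le> a"
  shows "(VHom D y1 y2 \<sqinter> VHom D y0 y1) \<sqinter> b \<le> a"
proof -
  \<comment> \<open>Currying with the implication from \<open>b\<close> to \<open>a\<close> lets the
    covering inequality pass through a meet. In the composition law of the quotient,
    \<open>b\<close> will be a meet of two homs of the algebra.\<close>
  from meet_adjoint[of b a] obtain r where r: "\<forall>x. x \<sqinter> b \<le> a \<longleftrightarrow> x \<le> r" ..
  have "VHom D y1 y2 \<sqinter> VHom D y0 y1 \<le> r"
    by (rule composable_pairs_le[OF y]) (use * r in simp)
  then show ?thesis using r by simp
qed

text \<open>The objects of \<open>P (p \<cdot> g)\<close> are pairs (x, z) with \<open>x\<close> and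
  \<open>g z\<close> in the same fibre of \<open>p\<close>, so the structure map is a partial binary
  operation. It is an action of the kernel pair of \<open>p\<close>: between \<open>g z\<close> and
  \<open>x\<close> there is only one way to move, hence \<open>act\<close> is indexed by the target
  \<open>x\<close> alone, and the last move decides the result.\<close>

lemma algebra_action:
  assumes "is_algebra E T (g, \<alpha>)"
  obtains a act where "g \<in> Obj E" "\<alpha> = (\<pi>1 (p \<cdot>\<^bsub>VCat\<^esub> g), a, g)" "a \<in> hom VCat (P (p \<cdot>\<^bsub>VCat\<^esub> g)) (Src g)"
    "\<And>w. w \<in> VOb (P (p \<cdot>\<^bsub>VCat\<^esub> g)) \<Longrightarrow>
      VMap a w = act (VMap (\<pi>1 (p \<cdot>\<^bsub>VCat\<^esub> g)) w) (VMap (\<pi>2 (p \<cdot>\<^bsub>VCat\<^esub> g)) w)"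
    "\<And>x z. x \<in> VOb C \<Longrightarrow> z \<in> VOb (Src g) \<Longrightarrow> VMap p x = VMap p (VMap g z) \<Longrightarrow>
      act x z \<in> VOb (Src g) \<and> VMap g (act x z) = x"
    "\<And>x z x' z'. x \<in> VOb C \<Longrightarrow> z \<in> VOb (Src g) \<Longrightarrow> VMap p x = VMap p (VMap g z) \<Longrightarrow>
      x' \<in> VOb C \<Longrightarrow> z' \<in> VOb (Src g) \<Longrightarrow> VMap p x' = VMap p (VMap g z') \<Longrightarrow>
      VHom C x x' \<sqinter> VHom (Src g) z z' \<le> VHom (Src g) (act x z) (act x' z')"
    "\<And>z. z \<in> VOb (Src g) \<Longrightarrow> act (VMap g z) z = z"
    "\<And>x x' z. x \<in> VOb C \<Longrightarrow> x' \<in> VOb C \<Longrightarrow> z \<in> VOb (Src g) \<Longrightarrow> VMap p x = VMap p (VMap g z) \<Longrightarrow>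
      VMap p x' = VMap p (VMap g z) \<Longrightarrow> act x (act x' z) = act x z"
proof -
  let ?pg = "p \<cdot>\<^bsub>VCat\<^esub> g" and ?Z = "Src g"
  let ?ppg = "p \<cdot>\<^bsub>VCat\<^esub> \<pi>1 ?pg"
  have g: "g \<in> Obj E" and \<alpha>: "\<alpha> \<in> hom E (\<pi>1 ?pg) g"
    and \<alpha>_unit: "\<alpha> \<cdot>\<^bsub>E\<^esub> descent_unit VCat p g = Id E g"
    and \<alpha>_mult: "\<alpha> \<cdot>\<^bsub>E\<^esub> AMap (Endo T) \<alpha> = \<alpha> \<cdot>\<^bsub>E\<^esub> AMap R (descent_counit VCat p ?pg)"
    using assms by (auto simp: is_algebra_iff Endo_T)
      (auto simp: descent_monad_def induced_monad_def postcomp_ftor_def)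
  have pg: "?pg \<in> Obj B" by (rule p_comp(1)[OF g])
  have ppg: "?ppg \<in> Obj B" by (rule p_comp(1)[OF \<pi>1_Obj[OF pg]])
  have gh: "g \<in> hom VCat ?Z C" using g by (simp add: Obj_E_iff)
  have pgz: "VMap ?pg z = VMap p (VMap g z)" if "z \<in> VOb ?Z" for z
    by (rule p_comp(3)[OF g that])
  obtain a where a: "\<alpha> = (\<pi>1 ?pg, a, g)" using \<alpha> by (auto simp: hom_slice_iff)
  have ah: "a \<in> hom VCat (P ?pg) ?Z" and ga: "\<And>w. w \<in> VOb (P ?pg) \<Longrightarrow> VMap g (VMap a w) = VMap (\<pi>1 ?pg) w"
    using \<alpha>[unfolded a] by (auto simp: hom_E_iff)
  define pt where "pt x z = (SOME u. u \<in> VOb (P ?pg) \<and> VMap (\<pi>1 ?pg) u = x \<and> VMap (\<pi>2 ?pg) u = z)" for x z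
  have pt: "pt x z \<in> VOb (P ?pg)" "VMap (\<pi>1 ?pg) (pt x z) = x" "VMap (\<pi>2 ?pg) (pt x z) = z"
    if "x \<in> VOb C" "z \<in> VOb ?Z" "VMap p x = VMap p (VMap g z)" for x z
  proof -
    have "\<exists>u. u \<in> VOb (P ?pg) \<and> VMap (\<pi>1 ?pg) u = x \<and> VMap (\<pi>2 ?pg) u = z"
      using point_ex[OF pg that(1), of z] that pgz by (auto simp: p_comp(2))
    from someI_ex[OF this] show "pt x z \<in> VOb (P ?pg)" "VMap (\<pi>1 ?pg) (pt x z) = x" "VMap (\<pi>2 ?pg) (pt x z) = z"
      by (auto simp: pt_def)
  qed
  have proj: "VMap (\<pi>1 ?pg) w \<in> VOb C" "VMap (\<pi>2 ?pg) w \<in> VOb ?Z"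
      "VMap p (VMap (\<pi>1 ?pg) w) = VMap p (VMap g (VMap (\<pi>2 ?pg) w))" if "w \<in> VOb (P ?pg)" for w
    using \<pi>_mem[OF pg that] pgz by (auto simp: p_comp(2))
  define act where "act x z = VMap a (pt x z)" for x z
  have a_act: "VMap a w = act (VMap (\<pi>1 ?pg) w) (VMap (\<pi>2 ?pg) w)" if w: "w \<in> VOb (P ?pg)" for w
    unfolding act_def
    by (rule arg_cong[of _ _ "VMap a"], rule point_eq[OF pg w]) (simp_all add: pt proj[OF w])
  have act: "act x z \<in> VOb ?Z \<and> VMap g (act x z) = x"
    if "x \<in> VOb C" "z \<in> VOb ?Z" "VMap p x = VMap p (VMap g z)" for x z
    unfolding act_def using VMap_mem[OF ah pt(1)[OF that]] ga[OF pt(1)[OF that]] pt(2)[OF that] by simp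
  have le: "VHom C x x' \<sqinter> VHom ?Z z z' \<le> VHom ?Z (act x z) (act x' z')"
    if "x \<in> VOb C" "z \<in> VOb ?Z" "VMap p x = VMap p (VMap g z)"
      "x' \<in> VOb C" "z' \<in> VOb ?Z" "VMap p x' = VMap p (VMap g z')" for x z x' z'
  proof -
    note u = pt[OF that(1-3)] and u' = pt[OF that(4-6)]
    have "VHom C x x' \<sqinter> VHom ?Z z z' \<le> VHom (P ?pg) (pt x z) (pt x' z')"
      using P_ge[OF pg u(1) u'(1)] u u' by (simp add: p_comp(2))
    also have "\<dots> \<le> VHom ?Z (act x z) (act x' z')"
      unfolding act_def by (rule VMap_le[OF ah u(1) u'(1)])
    finally show ?thesis .
  qed
  have unit: "act (VMap g z) z = z" if z: "z \<in> VOb ?Z" for z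
  proof -
    \<comment> \<open>The arrow underlying the unit of the monad, which sends \<open>z\<close> to
      the pair (g z, z).\<close>
    define e where "e = pb_induced VCat p ?pg g (Id VCat ?Z)"
    have Z: "?Z \<in> Obj VCat" using hom_VCat_vcategory(1)[OF gh] by (simp add: VCat_simps)
    have sq: "?pg \<cdot>\<^bsub>VCat\<^esub> Id VCat ?Z = ?pg"
      using V.comp_id[of ?pg ?Z D] pg by (simp add: Obj_B_iff p_comp(2))
    have "e \<in> hom VCat ?Z (P ?pg) \<and> \<pi>1 ?pg \<cdot>\<^bsub>VCat\<^esub> e = g \<and> \<pi>2 ?pg \<cdot>\<^bsub>VCat\<^esub> e = Id VCat ?Z"
      using V.pb_induced[of p ?pg g "Id VCat ?Z"] p pg gh V.id_hom[OF Z] sq unfolding e_def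
      by (simp add: hom_def VCat_simps(2-4) Obj_B_iff p_comp(2))
    then have e: "e \<in> hom VCat ?Z (P ?pg)" "\<pi>1 ?pg \<cdot>\<^bsub>VCat\<^esub> e = g" "\<pi>2 ?pg \<cdot>\<^bsub>VCat\<^esub> e = Id VCat ?Z" by auto
    have "a \<cdot>\<^bsub>VCat\<^esub> e = Id VCat ?Z"
      using \<alpha>_unit by (simp add: a descent_unit_def e_def slice_simps VCat_simps(3))
    then have "VMap a (VMap e z) = z"
      using VMap_comp[OF e(1) z, of a] VMap_Id[OF z] by simp
    moreover have "VMap (\<pi>1 ?pg) (VMap e z) = VMap g z" "VMap (\<pi>2 ?pg) (VMap e z) = z"
      using VMap_comp[OF e(1) z, of "\<pi>1 ?pg"] VMap_comp[OF e(1) z, of "\<pi>2 ?pg"] e VMap_Id[OF z] by simp_all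
    ultimately show ?thesis using a_act[OF VMap_mem[OF e(1) z]] by simp
  qed
  have assoc: "act x (act x' z) = act x z"
    if x: "x \<in> VOb C" and x': "x' \<in> VOb C" and z: "z \<in> VOb ?Z" and eq: "VMap p x = VMap p (VMap g z)"
      "VMap p x' = VMap p (VMap g z)" for x x' z
  proof -
    \<comment> \<open>Both sides of the multiplication law are evaluated at the object
      \<open>w\<close> = (x, (x', z)): \<open>k\<close> sends it to (x, act x' z), while
      \<open>m\<close>, coming from the multiplication, sends it to (x, z).\<close>
    obtain k where k: "AMap (Endo T) \<alpha> = (\<pi>1 ?ppg, k, \<pi>1 ?pg)" "k \<in> hom VCat (P ?ppg) (P ?pg)"
      "\<And>w. w \<in> VOb (P ?ppg) \<Longrightarrow> VMap (\<pi>1 ?pg) (VMap k w) = VMap (\<pi>1 ?ppg) w"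
      "\<And>w. w \<in> VOb (P ?ppg) \<Longrightarrow> VMap (\<pi>2 ?pg) (VMap k w) = VMap a (VMap (\<pi>2 ?ppg) w)"
      using T_map[OF \<alpha>[unfolded a]] unfolding a by metis
    obtain m where m: "AMap R (descent_counit VCat p ?pg) = (\<pi>1 ?ppg, m, \<pi>1 ?pg)" "m \<in> hom VCat (P ?ppg) (P ?pg)"
      "\<And>w. w \<in> VOb (P ?ppg) \<Longrightarrow> VMap (\<pi>1 ?pg) (VMap m w) = VMap (\<pi>1 ?ppg) w"
      "\<And>w. w \<in> VOb (P ?ppg) \<Longrightarrow> VMap (\<pi>2 ?pg) (VMap m w) = VMap (\<pi>2 ?pg) (VMap (\<pi>2 ?ppg) w)"
      using R_map[OF counit_hom(2)[OF pg]] unfolding counit_hom(1)[OF pg] by metis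
    have akm: "a \<cdot>\<^bsub>VCat\<^esub> k = a \<cdot>\<^bsub>VCat\<^esub> m"
      using \<alpha>_mult unfolding k m by (simp add: a slice_simps)
    note u = pt[OF x' z eq(2)]
    have "VMap p x = VMap ?ppg (pt x' z)"
      using p_comp(3)[OF \<pi>1_Obj[OF pg] u(1)] u(2) eq by simp
    then obtain w where w: "w \<in> VOb (P ?ppg)" "VMap (\<pi>1 ?ppg) w = x" "VMap (\<pi>2 ?ppg) w = pt x' z"
      using point_ex[OF ppg x, of "pt x' z"] u(1) by (auto simp: p_comp(2))
    have "act x (act x' z) = VMap a (VMap k w)"
      using a_act[OF VMap_mem[OF k(2) w(1)]] k(3,4)[OF w(1)] w by (simp add: act_def)
    also have "\<dots> = VMap a (VMap m w)"
      using akm VMap_comp[OF k(2) w(1), of a] VMap_comp[OF m(2) w(1), of a] by simp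
    also have "\<dots> = act x z"
      using a_act[OF VMap_mem[OF m(2) w(1)]] m(3,4)[OF w(1)] w u by simp
    finally show ?thesis .
  qed
  show thesis
    by (rule that[of a act, OF g a ah a_act act le unit assoc])
qed

section \<open>Essential surjectivity: the quotient of an algebra by its action\<close>

lemma K_ess_surj:
  assumes X: "is_algebra E T (g, \<alpha>)"
  shows "\<exists>f\<in>Obj B. \<exists>e\<in>hom (Alg E T) (OMap K f) (g, \<alpha>). is_iso (Alg E T) e"
proof -
  let ?pg = "p \<cdot>\<^bsub>VCat\<^esub> g" and ?Z = "Src g"
  obtain a act where g: "g \<in> Obj E" and a: "\<alpha> = (\<pi>1 ?pg, a, g)" "a \<in> hom VCat (P ?pg) ?Z"
    and a_act: "\<And>w. w \<in> VOb (P ?pg) \<Longrightarrow> VMap a w = act (VMap (\<pi>1 ?pg) w) (VMap (\<pi>2 ?pg) w)"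
    and act': "\<And>x z. x \<in> VOb C \<Longrightarrow> z \<in> VOb ?Z \<Longrightarrow> VMap p x = VMap p (VMap g z) \<Longrightarrow>
      act x z \<in> VOb ?Z \<and> VMap g (act x z) = x"
    and act_le: "\<And>x z x' z'. x \<in> VOb C \<Longrightarrow> z \<in> VOb ?Z \<Longrightarrow> VMap p x = VMap p (VMap g z) \<Longrightarrow>
      x' \<in> VOb C \<Longrightarrow> z' \<in> VOb ?Z \<Longrightarrow> VMap p x' = VMap p (VMap g z') \<Longrightarrow>
      VHom C x x' \<sqinter> VHom ?Z z z' \<le> VHom ?Z (act x z) (act x' z')"
    and unit: "\<And>z. z \<in> VOb ?Z \<Longrightarrow> act (VMap g z) z = z"
    and assoc: "\<And>x x' z. x \<in> VOb C \<Longrightarrow> x' \<in> VOb C \<Longrightarrow> z \<in> VOb ?Z \<Longrightarrow>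
      VMap p x = VMap p (VMap g z) \<Longrightarrow> VMap p x' = VMap p (VMap g z) \<Longrightarrow> act x (act x' z) = act x z"
    by (rule algebra_action[OF X]) (rule that)
  \<comment> \<open>The composite to \<open>D\<close>. It is constant on orbits, and
    \<open>act x z\<close> is meaningful exactly for \<open>x\<close> over \<open>\<beta> z\<close>,
    so the orbit of \<open>z\<close> contains one object over each such \<open>x\<close>.\<close>
  define \<beta> where "\<beta> z = VMap p (VMap g z)" for z
  have gh: "g \<in> hom VCat ?Z C" using g by (simp add: Obj_E_iff)
  have Z: "vcategory ?Z" and Dc: "vcategory D"
    using hom_VCat_vcategory(1)[OF gh] hom_VCat_vcategory(2)[OF p] by auto
  have g_mem: "VMap g z \<in> VOb C" if "z \<in> VOb ?Z" for z using VMap_mem[OF gh that] .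
  have \<beta>_mem: "\<beta> z \<in> VOb D" if "z \<in> VOb ?Z" for z
    unfolding \<beta>_def by (rule VMap_mem[OF p g_mem[OF that]])
  have \<beta>_le: "VHom ?Z z z' \<le> VHom D (\<beta> z) (\<beta> z')" if "z \<in> VOb ?Z" "z' \<in> VOb ?Z" for z z'
    unfolding \<beta>_def by (rule order_trans[OF VMap_le[OF gh that] VMap_le[OF p g_mem g_mem]]) (fact that)+
  have act: "act x z \<in> VOb ?Z" "VMap g (act x z) = x" "\<beta> (act x z) = \<beta> z"
    if "x \<in> VOb C" "z \<in> VOb ?Z" "VMap p x = \<beta> z" for x z
    using act'[OF that(1,2)] that(3) by (auto simp: \<beta>_def)
  have act_le: "VHom C x x' \<sqinter> VHom ?Z z z' \<le> VHom ?Z (act x z) (act x' z')"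
    if "x \<in> VOb C" "z \<in> VOb ?Z" "VMap p x = \<beta> z" "x' \<in> VOb C" "z' \<in> VOb ?Z" "VMap p x' = \<beta> z'" for x z x' z'
    using act_le that by (simp add: \<beta>_def)
  have assoc: "act x (act x' z) = act x z"
    if "x \<in> VOb C" "x' \<in> VOb C" "z \<in> VOb ?Z" "VMap p x = \<beta> z" "VMap p x' = \<beta> z" for x x' z
    using assoc that by (simp add: \<beta>_def)
  define s where "s y = (SOME x. x \<in> VOb C \<and> VMap p x = y)" for y
  have s: "s y \<in> VOb C" "VMap p (s y) = y" if "y \<in> VOb D" for y
    using someI_ex[of "\<lambda>x. x \<in> VOb C \<and> VMap p x = y"] surj[OF that] unfolding s_def by auto
  define rep where "rep z = act (s (\<beta> z)) z" for z
  text \<open>The orbit of \<open>z\<close> is represented by its member over \<open>s (\<beta> z)\<close>, so that \<open>Q\<close> has its objects in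
    the same universe as \<open>Z\<close>.\<close>
  define Qo where "Qo = {z \<in> VOb ?Z. VMap g z = s (\<beta> z)}"
  define Q where "Q = \<lparr>VOb = Qo, VHom = \<lambda>v v'.
    \<Squnion>{VHom ?Z (act x v) (act x' v') | x x'. x \<in> VOb C \<and> x' \<in> VOb C \<and> VMap p x = \<beta> v \<and> VMap p x' = \<beta> v'}\<rparr>"
  have VQ [simp]: "VOb Q = Qo" by (simp add: Q_def)
  have QZ: "v \<in> VOb ?Z" if "v \<in> Qo" for v using that by (simp add: Qo_def)
  have Q_ge: "VHom ?Z (act x v) (act x' v') \<le> VHom Q v v'"
    if "x \<in> VOb C" "x' \<in> VOb C" "VMap p x = \<beta> v" "VMap p x' = \<beta> v'" for x x' v v'
    unfolding Q_def using that by (auto intro: join_upper)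
  have Q_le: "VHom Q v v' \<le> t" if "\<And>x x'. x \<in> VOb C \<Longrightarrow> x' \<in> VOb C \<Longrightarrow> VMap p x = \<beta> v \<Longrightarrow> VMap p x' = \<beta> v' \<Longrightarrow>
      VHom ?Z (act x v) (act x' v') \<le> t" for v v' t
    unfolding Q_def using that by (auto intro: join_least)
  \<comment> \<open>Homs of \<open>Q\<close> are joins, and meets distribute over them by the
    Heyting implication; a join inside a meet may therefore be eliminated member by member.\<close>
  have Q_meet_le: "VHom Q v v' \<sqinter> b \<le> t" if *: "\<And>x x'. x \<in> VOb C \<Longrightarrow> x' \<in> VOb C \<Longrightarrow> VMap p x = \<beta> v \<Longrightarrow> VMap p x' = \<beta> v' \<Longrightarrow>
      VHom ?Z (act x v) (act x' v') \<sqinter> b \<le> t" for v v' b t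
  proof -
    from meet_adjoint[of b t] obtain r where r: "\<forall>x. x \<sqinter> b \<le> t \<longleftrightarrow> x \<le> r" ..
    have "VHom Q v v' \<le> r" by (rule Q_le) (use * r in simp)
    then show ?thesis using r by simp
  qed
  have Q_meet_le': "b \<sqinter> VHom Q v v' \<le> t" if "\<And>x x'. x \<in> VOb C \<Longrightarrow> x' \<in> VOb C \<Longrightarrow> VMap p x = \<beta> v \<Longrightarrow> VMap p x' = \<beta> v' \<Longrightarrow>
      b \<sqinter> VHom ?Z (act x v) (act x' v') \<le> t" for v v' b t
    by (rule order_trans[OF meet_commute_le Q_meet_le[OF order_trans[OF meet_commute_le that]]])
  have Q: "vcategory Q"
  proof
    fix v assume "v \<in> VOb Q"
    then have v: "v \<in> VOb ?Z" using QZ by simp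
    have "VHom ?Z v v \<le> VHom Q v v"
      using Q_ge[OF g_mem[OF v] g_mem[OF v] \<beta>_def[symmetric] \<beta>_def[symmetric]] unfolding unit[OF v] .
    with vcategory.vid[OF Z v] show "\<top> \<le> VHom Q v v" by (rule order_trans)
  next
    fix v0 v1 v2 assume "v0 \<in> VOb Q" "v1 \<in> VOb Q" "v2 \<in> VOb Q"
    then have v: "v0 \<in> VOb ?Z" "v1 \<in> VOb ?Z" "v2 \<in> VOb ?Z" using QZ by auto
    show "VHom Q v1 v2 \<sqinter> VHom Q v0 v1 \<le> VHom Q v0 v2"
    \<comment> \<open>The two joins are eliminated independently, so the middle objects
      \<open>act x1' v1\<close> and \<open>act x1 v1\<close> lie in one orbit but may differ, and
      \<open>?M\<close> and \<open>?N\<close> cannot be composed directly.\<close>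
    proof (rule Q_meet_le, rule Q_meet_le')
      fix x1' x2 x0 x1 assume x: "x1' \<in> VOb C" "x2 \<in> VOb C" "VMap p x1' = \<beta> v1" "VMap p x2 = \<beta> v2"
        "x0 \<in> VOb C" "x1 \<in> VOb C" "VMap p x0 = \<beta> v0" "VMap p x1 = \<beta> v1"
      note w1' = act[OF x(1) v(2) x(3)] and w2 = act[OF x(2) v(3) x(4)]
        and w0 = act[OF x(5) v(1) x(7)] and w1 = act[OF x(6) v(2) x(8)]
      let ?M = "VHom ?Z (act x1' v1) (act x2 v2)" and ?N = "VHom ?Z (act x0 v0) (act x1 v1)"
      have "?M \<sqinter> ?N \<le> VHom D (\<beta> v1) (\<beta> v2) \<sqinter> VHom D (\<beta> v0) (\<beta> v1)"
        using \<beta>_le[OF w1'(1) w2(1)] \<beta>_le[OF w0(1) w1(1)] w1' w2 w0 w1 by (intro meet_mono) simp_all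
      \<comment> \<open>The image of the pair in \<open>D\<close> is added as a factor and
        \<open>?M\<close>, \<open>?N\<close> are kept: the former will be replaced by lifts in
        \<open>C\<close>, which then act on the latter.\<close>
      then have "?M \<sqinter> ?N \<le> (VHom D (\<beta> v1) (\<beta> v2) \<sqinter> VHom D (\<beta> v0) (\<beta> v1)) \<sqinter> (?M \<sqinter> ?N)"
        by (rule meet_greatest[OF _ order_refl])
      also have "\<dots> \<le> VHom Q v0 v2"
      proof (rule composable_pairs_meet_le[OF \<beta>_mem[OF v(1)] \<beta>_mem[OF v(2)] \<beta>_mem[OF v(3)]])
        fix c0 c1 c2 assume c: "c0 \<in> VOb C" "c1 \<in> VOb C" "c2 \<in> VOb C"
          "VMap p c0 = \<beta> v0" "VMap p c1 = \<beta> v1" "VMap p c2 = \<beta> v2"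
        \<comment> \<open>By \<open>assoc\<close> the earlier moves to \<open>x1'\<close> and
          \<open>x1\<close> are overwritten: after acting with \<open>c1\<close>, both middle
          objects are \<open>act c1 v1\<close>, and composition in \<open>Src g\<close>
          applies.\<close>
        have "VHom C c1 c2 \<sqinter> ?M \<le> VHom ?Z (act c1 v1) (act c2 v2)"
          using act_le[OF c(2) w1'(1) _ c(3) w2(1)] c w1' w2 assoc x v by simp
        moreover have "VHom C c0 c1 \<sqinter> ?N \<le> VHom ?Z (act c0 v0) (act c1 v1)"
          using act_le[OF c(1) w0(1) _ c(2) w1(1)] c w0 w1 assoc x v by simp
        ultimately have "(VHom C c1 c2 \<sqinter> ?M) \<sqinter> (VHom C c0 c1 \<sqinter> ?N) \<le>
            VHom ?Z (act c1 v1) (act c2 v2) \<sqinter> VHom ?Z (act c0 v0) (act c1 v1)"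
          by (rule meet_mono)
        moreover have "(VHom C c1 c2 \<sqinter> VHom C c0 c1) \<sqinter> (?M \<sqinter> ?N) \<le>
            (VHom C c1 c2 \<sqinter> ?M) \<sqinter> (VHom C c0 c1 \<sqinter> ?N)"
          by (intro meet_greatest meet_mono meet_le1 meet_le2)
        moreover have "VHom ?Z (act c1 v1) (act c2 v2) \<sqinter> VHom ?Z (act c0 v0) (act c1 v1) \<le>
            VHom ?Z (act c0 v0) (act c2 v2)"
          by (intro vcategory.vcomp[OF Z] act c v)
        moreover have "VHom ?Z (act c0 v0) (act c2 v2) \<le> VHom Q v0 v2"
          by (rule Q_ge[OF c(1,3,4,6)])
        ultimately show "(VHom C c1 c2 \<sqinter> VHom C c0 c1) \<sqinter> (?M \<sqinter> ?N) \<le> VHom Q v0 v2"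
          by (blast intro: order_trans)
      qed
      finally show "?M \<sqinter> ?N \<le> VHom Q v0 v2" .
    qed
  qed
  define f where "f = \<lparr>Src = Q, Tgt = D, VMap = restrict \<beta> (VOb Q)\<rparr>"
  have f_simps [simp]: "Src f = Q" "\<And>v. v \<in> Qo \<Longrightarrow> VMap f v = \<beta> v" by (simp_all add: f_def)
  have "f \<in> hom VCat Q D"
    unfolding f_def
  proof (rule hom_VCatI[OF Q Dc])
    show "\<beta> v \<in> VOb D" if "v \<in> VOb Q" for v using that QZ \<beta>_mem by simp
    fix v v' assume v: "v \<in> VOb Q" "v' \<in> VOb Q"
    show "VHom Q v v' \<le> VHom D (\<beta> v) (\<beta> v')"
    proof (rule Q_le)
      fix x x' assume x: "x \<in> VOb C" "x' \<in> VOb C" "VMap p x = \<beta> v" "VMap p x' = \<beta> v'"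
      have v: "v \<in> VOb ?Z" "v' \<in> VOb ?Z" using v QZ by auto
      show "VHom ?Z (act x v) (act x' v') \<le> VHom D (\<beta> v) (\<beta> v')"
        using \<beta>_le[OF act(1)[OF x(1) v(1) x(3)] act(1)[OF x(2) v(2) x(4)]]
          act(3)[OF x(1) v(1) x(3)] act(3)[OF x(2) v(2) x(4)] by simp
    qed
  qed
  then have f: "f \<in> Obj B" by (simp add: Obj_B_iff)
  have \<pi>: "VMap (\<pi>1 f) u \<in> VOb C" "VMap (\<pi>2 f) u \<in> Qo" "VMap (\<pi>2 f) u \<in> VOb ?Z"
      "VMap p (VMap (\<pi>1 f) u) = \<beta> (VMap (\<pi>2 f) u)" if "u \<in> VOb (P f)" for u
    using \<pi>_mem[OF f that] QZ by auto
  have P: "vcategory (P f)" using hom_VCat_vcategory(1)[OF \<pi>_hom(1)[OF f]] .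
  \<comment> \<open>The isomorphism from the pullback of \<open>Q\<close> to the algebra sends (x,
    v) to \<open>act x v\<close>; its inverse \<open>\<theta>'\<close> sends \<open>z\<close> to (g
    z, rep z).\<close>
  define \<theta> where "\<theta> = \<lparr>Src = P f, Tgt = ?Z, VMap = restrict (\<lambda>u. act (VMap (\<pi>1 f) u) (VMap (\<pi>2 f) u)) (VOb (P f))\<rparr>"
  have \<theta>V: "VMap \<theta> u = act (VMap (\<pi>1 f) u) (VMap (\<pi>2 f) u)" if "u \<in> VOb (P f)" for u
    using that by (simp add: \<theta>_def)
  have \<theta>: "\<theta> \<in> hom VCat (P f) ?Z"
    unfolding \<theta>_def
  proof (rule hom_VCatI[OF P Z])
    show "act (VMap (\<pi>1 f) u) (VMap (\<pi>2 f) u) \<in> VOb ?Z" if "u \<in> VOb (P f)" for u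
      using \<pi>[OF that] act by blast
    fix u u' assume u: "u \<in> VOb (P f)" "u' \<in> VOb (P f)"
    let ?x = "VMap (\<pi>1 f) u" and ?v = "VMap (\<pi>2 f) u" and ?x' = "VMap (\<pi>1 f) u'" and ?v' = "VMap (\<pi>2 f) u'"
    note \<pi>u = \<pi>[OF u(1)] and \<pi>u' = \<pi>[OF u(2)]
    have "VHom (P f) u u' \<le> VHom C ?x ?x' \<sqinter> VHom Q ?v ?v'"
      using \<pi>_le[OF f u] by (intro meet_greatest) simp_all
    also have "\<dots> \<le> VHom ?Z (act ?x ?v) (act ?x' ?v')"
    \<comment> \<open>A member of the join defining the hom of \<open>Q\<close> connects
      \<open>act x ?v\<close> to \<open>act x' ?v'\<close>; acting with the hom from
      \<open>?x\<close> to \<open>?x'\<close> moves both ends to the required objects.\<close>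
    proof (rule Q_meet_le')
      fix x x' assume x: "x \<in> VOb C" "x' \<in> VOb C" "VMap p x = \<beta> ?v" "VMap p x' = \<beta> ?v'"
      note w = act[OF x(1) \<pi>u(3) x(3)] and w' = act[OF x(2) \<pi>u'(3) x(4)]
      show "VHom C ?x ?x' \<sqinter> VHom ?Z (act x ?v) (act x' ?v') \<le> VHom ?Z (act ?x ?v) (act ?x' ?v')"
        using act_le[OF \<pi>u(1) w(1) _ \<pi>u'(1) w'(1)] w w' \<pi>u \<pi>u' x assoc by simp
    qed
    finally show "VHom (P f) u u' \<le> VHom ?Z (act ?x ?v) (act ?x' ?v')" .
  qed
  have rep: "rep z \<in> Qo" "\<beta> (rep z) = \<beta> z" "rep z \<in> VOb ?Z" if "z \<in> VOb ?Z" for z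
    using act[OF s(1)[OF \<beta>_mem[OF that]] that s(2)[OF \<beta>_mem[OF that]]] by (auto simp: rep_def Qo_def)
  have act_rep: "act x (rep z) = act x z" if "x \<in> VOb C" "z \<in> VOb ?Z" "VMap p x = \<beta> z" for x z
    unfolding rep_def using assoc that s[OF \<beta>_mem[OF that(2)]] by simp
  have rep_act: "rep (act x v) = v" if "x \<in> VOb C" "v \<in> Qo" "VMap p x = \<beta> v" for x v
  proof -
    have v: "v \<in> VOb ?Z" "VMap g v = s (\<beta> v)" using that(2) by (auto simp: Qo_def)
    have "rep (act x v) = act (s (\<beta> v)) v"
      unfolding rep_def using act(3)[OF that(1) v(1) that(3)] assoc[OF _ that(1) v(1) _ that(3)] s[OF \<beta>_mem[OF v(1)]] by simp
    then show ?thesis using unit[OF v(1)] v(2) by simp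
  qed
  define pt where "pt z = (SOME u. u \<in> VOb (P f) \<and> VMap (\<pi>1 f) u = VMap g z \<and> VMap (\<pi>2 f) u = rep z)" for z
  have pt: "pt z \<in> VOb (P f)" "VMap (\<pi>1 f) (pt z) = VMap g z" "VMap (\<pi>2 f) (pt z) = rep z" if z: "z \<in> VOb ?Z" for z
  proof -
    have "\<exists>u. u \<in> VOb (P f) \<and> VMap (\<pi>1 f) u = VMap g z \<and> VMap (\<pi>2 f) u = rep z"
      using point_ex[OF f g_mem[OF z], of "rep z"] rep[OF z] by (auto simp: \<beta>_def)
    from someI_ex[OF this] show "pt z \<in> VOb (P f)" "VMap (\<pi>1 f) (pt z) = VMap g z" "VMap (\<pi>2 f) (pt z) = rep z"
      by (auto simp: pt_def)
  qed
  define \<theta>' where "\<theta>' = \<lparr>Src = ?Z, Tgt = P f, VMap = restrict pt (VOb ?Z)\<rparr>"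
  have \<theta>'V: "VMap \<theta>' z = pt z" if "z \<in> VOb ?Z" for z using that by (simp add: \<theta>'_def)
  have \<theta>': "\<theta>' \<in> hom VCat ?Z (P f)"
    unfolding \<theta>'_def
  proof (rule hom_VCatI[OF Z P pt(1)])
    fix z z' assume z: "z \<in> VOb ?Z" "z' \<in> VOb ?Z"
    \<comment> \<open>The hom from \<open>z\<close> to \<open>z'\<close> is itself a member of the
      join, namely the one indexed by \<open>g z\<close> and \<open>g z'\<close>, because acting
      with \<open>g z\<close> on \<open>rep z\<close> gives back \<open>z\<close>.\<close>
    have "VHom ?Z z z' \<le> VHom Q (rep z) (rep z')"
      using Q_ge[OF g_mem[OF z(1)] g_mem[OF z(2)], of "rep z" "rep z'"] rep[OF z(1)] rep[OF z(2)]
        act_rep[OF g_mem[OF z(1)] z(1)] act_rep[OF g_mem[OF z(2)] z(2)] unit z by (simp add: \<beta>_def)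
    then have "VHom ?Z z z' \<le> VHom C (VMap g z) (VMap g z') \<sqinter> VHom Q (rep z) (rep z')"
      by (intro meet_greatest VMap_le[OF gh z])
    also have "\<dots> \<le> VHom (P f) (pt z) (pt z')"
      using P_ge[OF f pt(1)[OF z(1)] pt(1)[OF z(2)]] pt z by simp
    finally show "VHom ?Z z z' \<le> VHom (P f) (pt z) (pt z')" .
  qed
  have \<theta>E: "(\<pi>1 f, \<theta>, g) \<in> hom E (\<pi>1 f) g"
    using \<pi>1_Obj[OF f] g \<theta> \<theta>V act \<pi> by (simp add: hom_E_iff)
  have \<theta>'E: "(g, \<theta>', \<pi>1 f) \<in> hom E g (\<pi>1 f)"
    using \<pi>1_Obj[OF f] g \<theta>' \<theta>'V pt by (simp add: hom_E_iff)
  have id1: "\<theta>' \<cdot>\<^bsub>VCat\<^esub> \<theta> = Id VCat (P f)"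
  proof (rule hom_VCat_eqI[OF V.comp_hom[OF \<theta> \<theta>']])
    show "Id VCat (P f) \<in> hom VCat (P f) (P f)" using P by (intro V.id_hom) (simp add: VCat_simps)
    fix u assume u: "u \<in> VOb (P f)"
    note z = VMap_mem[OF \<theta> u]
    have "pt (VMap \<theta> u) = u"
      by (rule point_eq[OF f pt(1)[OF z] u])
        (simp_all add: pt z, simp_all add: \<theta>V u \<pi> act rep_act)
    then show "VMap (\<theta>' \<cdot>\<^bsub>VCat\<^esub> \<theta>) u = VMap (Id VCat (P f)) u"
      using u z by (simp add: VMap_comp[OF \<theta> u] \<theta>'V VMap_Id)
  qed
  have id2: "\<theta> \<cdot>\<^bsub>VCat\<^esub> \<theta>' = Id VCat ?Z"
  proof (rule hom_VCat_eqI[OF V.comp_hom[OF \<theta>' \<theta>]])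
    show "Id VCat ?Z \<in> hom VCat ?Z ?Z" using Z by (intro V.id_hom) (simp add: VCat_simps)
    fix z assume z: "z \<in> VOb ?Z"
    show "VMap (\<theta> \<cdot>\<^bsub>VCat\<^esub> \<theta>') z = VMap (Id VCat ?Z) z"
      using z act_rep[OF g_mem[OF z] z] unit[OF z] by (simp add: VMap_comp[OF \<theta>' z] \<theta>'V VMap_Id \<theta>V pt \<beta>_def)
  qed
  let ?pf = "p \<cdot>\<^bsub>VCat\<^esub> \<pi>1 f"
  have pf: "?pf \<in> Obj B" by (rule p_comp(1)[OF \<pi>1_Obj[OF f]])
  obtain b where b: "snd (OMap K f) = (\<pi>1 ?pf, b, \<pi>1 f)" "b \<in> hom VCat (P ?pf) (P f)"
    "\<And>w. w \<in> VOb (P ?pf) \<Longrightarrow> VMap (\<pi>1 f) (VMap b w) = VMap (\<pi>1 ?pf) w"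
    "\<And>w. w \<in> VOb (P ?pf) \<Longrightarrow> VMap (\<pi>2 f) (VMap b w) = VMap (\<pi>2 f) (VMap (\<pi>2 ?pf) w)"
    using K_action[OF f] by metis
  obtain k where k: "AMap (Endo T) (\<pi>1 f, \<theta>, g) = (\<pi>1 ?pf, k, \<pi>1 ?pg)" "k \<in> hom VCat (P ?pf) (P ?pg)"
    "\<And>w. w \<in> VOb (P ?pf) \<Longrightarrow> VMap (\<pi>1 ?pg) (VMap k w) = VMap (\<pi>1 ?pf) w"
    "\<And>w. w \<in> VOb (P ?pf) \<Longrightarrow> VMap (\<pi>2 ?pg) (VMap k w) = VMap \<theta> (VMap (\<pi>2 ?pf) w)"
    using T_map[OF \<theta>E] by metis
  \<comment> \<open>At \<open>w\<close> = (x, (x', v)) the left side is \<open>act x v\<close> and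
    the right side is \<open>act x (act x' v)\<close>, so equivariance of \<open>\<theta>\<close> is
    the associativity of the action.\<close>
  have equi: "\<theta> \<cdot>\<^bsub>VCat\<^esub> b = a \<cdot>\<^bsub>VCat\<^esub> k"
  proof (rule hom_VCat_eqI[OF V.comp_hom[OF b(2) \<theta>] V.comp_hom[OF k(2) a(2)]])
    fix w assume w: "w \<in> VOb (P ?pf)"
    let ?x = "VMap (\<pi>1 ?pf) w" and ?u = "VMap (\<pi>2 ?pf) w"
    have u: "?u \<in> VOb (P f)" and x: "?x \<in> VOb C" and "VMap p ?x = VMap ?pf ?u"
      using \<pi>_mem[OF pf w] by (simp_all add: p_comp(2))
    then have px: "VMap p ?x = \<beta> (VMap (\<pi>2 f) ?u)"
      using p_comp(3)[OF \<pi>1_Obj[OF f] u] \<pi>[OF u] by simp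
    have "VMap (\<theta> \<cdot>\<^bsub>VCat\<^esub> b) w = act ?x (VMap (\<pi>2 f) ?u)"
      using VMap_comp[OF b(2) w] \<theta>V[OF VMap_mem[OF b(2) w]] b(3,4)[OF w] by simp
    also have "\<dots> = act ?x (VMap \<theta> ?u)"
      using assoc[OF x \<pi>(1)[OF u] \<pi>(3)[OF u] px \<pi>(4)[OF u]] \<theta>V[OF u] by simp
    also have "\<dots> = VMap (a \<cdot>\<^bsub>VCat\<^esub> k) w"
      using VMap_comp[OF k(2) w] a_act[OF VMap_mem[OF k(2) w]] k(3,4)[OF w] by simp
    finally show "VMap (\<theta> \<cdot>\<^bsub>VCat\<^esub> b) w = VMap (a \<cdot>\<^bsub>VCat\<^esub> k) w" .
  qed
  have Kf: "is_algebra E T (OMap K f)"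
    using is_functor.map_obj[OF K_functor f] by (simp add: Alg_simps)
  have e: "(OMap K f, (\<pi>1 f, \<theta>, g), (g, \<alpha>)) \<in> hom (Alg E T) (OMap K f) (g, \<alpha>)"
    using Kf X \<theta>E equi by (simp add: hom_Alg_iff b k) (simp add: K_simps(1) a slice_simps)
  moreover have "is_iso (Alg E T) (OMap K f, (\<pi>1 f, \<theta>, g), (g, \<alpha>))"
    by (rule is_iso_Alg[OF Endo_functor e, of "(g, \<theta>', \<pi>1 f)"])
      (use \<theta>'E id1 id2 in \<open>simp_all add: K_simps(1) slice_simps VCat_simps(3)\<close>)
  ultimately show ?thesis using f by blast
qed

theorem effective_descent_VCat: "effective_descent VCat p"
proof -
  have "is_equivalence B (Alg E T) K"
  proof (rule is_functor.is_equivalenceI[OF K_functor])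
    fix X assume "X \<in> Obj (Alg E T)"
    then show "\<exists>f\<in>Obj B. \<exists>e\<in>hom (Alg E T) (OMap K f) X. is_iso (Alg E T) e"
      using K_ess_surj[of "fst X" "snd X"] by (simp add: Alg_simps)
  qed (fact K_faithful K_full)+
  then show ?thesis
    using p by (simp add: effective_descent_def hom_VCat_iff VCat_simps(2-4))
qed

end

text \<open>If \<open>\<top>\<close> is isomorphic to \<open>\<Squnion>{}\<close>, then all elements
  of \<open>'v\<close> are isomorphic, \<V>-categories are in effect bare sets, and the covering
  condition holds for every \<open>F\<close>, even one with empty domain. \<open>degenerate\<close>
  supplies surjectivity on objects in this case; in every other case it follows from the covering
  condition.\<close>

theorem theorem3p4p6:
  fixes C D :: "('u::infinite, 'v::complete_heyting) vcat"
    and F :: "('u, 'v) vfun"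
  assumes F: "F \<in> hom VCat C D"
    and degenerate: "(\<top>::'v) \<cong> \<Squnion>{} \<Longrightarrow> VMap F ` VOb C = VOb D"
    and descent: "\<And>y0 y1 y2. y0 \<in> VOb D \<Longrightarrow> y1 \<in> VOb D \<Longrightarrow> y2 \<in> VOb D \<Longrightarrow>
      (\<Squnion>(x0, x1, x2) \<in> {(x0, x1, x2). x0 \<in> VOb C \<and> x1 \<in> VOb C \<and> x2 \<in> VOb C \<and>
           VMap F x0 = y0 \<and> VMap F x1 = y1 \<and> VMap F x2 = y2}.
         VHom C x1 x2 \<sqinter> VHom C x0 x1)
      \<cong> VHom D y1 y2 \<sqinter> VHom D y0 y1"
  shows "effective_descent VCat F"
proof -
  have pairs: "VHom D y1 y2 \<sqinter> VHom D y0 y1 \<le> a"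
    if y: "y0 \<in> VOb D" "y1 \<in> VOb D" "y2 \<in> VOb D"
      and *: "\<And>x0 x1 x2. x0 \<in> VOb C \<Longrightarrow> x1 \<in> VOb C \<Longrightarrow> x2 \<in> VOb C \<Longrightarrow> VMap F x0 = y0 \<Longrightarrow>
        VMap F x1 = y1 \<Longrightarrow> VMap F x2 = y2 \<Longrightarrow> VHom C x1 x2 \<sqinter> VHom C x0 x1 \<le> a" for y0 y1 y2 a
    by (rule order_trans[OF conjunct2[OF descent[OF y, unfolded thin_iso_def]]], rule join_least)
      (use * in auto)
  have "\<exists>x\<in>VOb C. VMap F x = y" if y: "y \<in> VOb D" for y
  proof (rule ccontr)
    assume no: "\<not> ?thesis"
    have D: "vcategory D" using F by (rule hom_VCat_vcategory)
    have "\<top> \<le> VHom D y y \<sqinter> VHom D y y"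
      by (intro meet_greatest vcategory.vid[OF D y])
    \<comment> \<open>An object \<open>y\<close> outside the image has no lifts, so every element is
      vacuously a bound in \<open>pairs\<close>; taking \<open>\<Squnion>{}\<close> forces
      \<open>'v\<close> to be degenerate.\<close>
    also have "\<dots> \<le> \<Squnion>{}" by (rule pairs[OF y y y]) (use no in blast)
    finally have "(\<top>::'v) \<cong> \<Squnion>{}" by (simp add: thin_iso_def le_one)
    with degenerate y no show False by (metis imageE)
  qed
  with F pairs interpret descent_vfunctor F C D by unfold_locales blast+
  show ?thesis by (rule effective_descent_VCat)
qed

end
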